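(* Let $\Omega$ be either an open and bounded subset of $\mathbb{R}^n$, or equal to $\mathbb{R}^n$. Let $g\in L^1_{\rm loc}(\mathbb{R}^n)$, and let $r_k>0$ be a sequence with $r_k\to r\in(0,+\infty)$. Then the following holds. (1) $\mathrm{Per}_{r_k}(E,\Omega)\to\mathrm{Per}_r(E,\Omega)$ and $\mathcal{F}_{r_k,g}(E,\Omega)\to\mathcal{F}_{r,g}(E,\Omega)$ for all $E\subseteq\mathbb{R}^n$. (2) $\mathrm{Per}_{r_k}(\cdot,\Omega)$ (resp. $\mathcal{F}_{r_k,g}(\cdot,\Omega)$) $\Gamma$-converges in $L^1_{\rm loc}(\Omega)$ to $\mathrm{Per}_r(\cdot,\Omega)$ (resp. to $\mathcal{F}_{r,g}(\cdot,\Omega)$). (3) Let $E_k\subseteq\mathbb{R}^n$ be such that $\sup_{k\in\mathbb{N}}\mathrm{Per}_{r_k}(E_k,\Omega)<+\infty$. Assume that, up to subsequences, $\chi_{E_k}\rightharpoonup u$ weakly in $L^1_{\rm loc}(\Omega)$, with $u:\mathbb{R}^n\to[0,1]$. Let $\Sigma:=\{x\in\Omega:\ u(x)\in(0,1)\}$ and $$\ell:=\liminf_{k\to+\infty}\mathrm{Per}_{r_k}(E_k,\Omega).$$ Then $$\mathcal{L}^n\big((\Sigma\oplus B_r)\cap\Omega\big)\le 2\ell r,\qquad \chi_{E_k}\to u\ \text{ in } L^1_{\rm loc}(\Omega\setminus\Sigma),\qquad \int_\Omega \operatorname*{osc}_{B_r(x)}u\,dx\le 2r\ell .$$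
   Context: $B_\rho(x)$ is the ball of radius $\rho$ centered at $x$ in $\mathbb{R}^n$, and $\mathcal{L}^n$ is the $n$-dimensional Lebesgue measure. For $A\subseteq\mathbb{R}^n$, $A\oplus B_r:=\bigcup_{x\in A}B_r(x)$. Measurable sets (including $\Sigma$) are identified with their sets of points of density one, and $\partial E$ denotes the topological boundary of the set of points of density one of $E$. For $r>0$, a domain $\Omega\subseteq\mathbb{R}^n$, measurable $E\subseteq\mathbb{R}^n$ and $g\in L^1_{\rm loc}(\mathbb{R}^n)$, $$\mathrm{Per}_r(E,\Omega):=\frac{1}{2r}\mathcal{L}^n\Big(\big((\partial E)\oplus B_r\big)\cap\Omega\Big),\qquad \mathcal{F}_{r,g}(E,\Omega):=\mathrm{Per}_r(E,\Omega)+\int_{E\cap\Omega}g(x)\,dx .$$ For a function $u$, $\operatorname*{osc}_{B_r(x)}u:=\sup_{B_r(x)}u-\inf_{B_r(x)}u$, where $\sup$ and $\inf$ denote the essential supremum and infimum. $\Gamma$-convergence in $L^1_{\rm loc}(\Omega)$ of functionals on sets refers to convergence of characteristic functions in $L^1_{\rm loc}(\Omega)$.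
   Formalization: For bounded Ω, Γ-convergence and the oscillation bound use (weak) convergence in L¹_loc(Ω⊕B_r) instead of L¹_loc(Ω); for Ω=Rⁿ, Γ-convergence of F assumes the negative part of g is integrable; ℓ is the liminf along the weakly convergent subsequence. *)

theory Defs
  imports "HOL-Analysis.Analysis" "HOL-Probability.Essential_Supremum"
begin

text \<open>
  \<open>\<real>\<^sup>n\<close> is an arbitrary type of class \<open>euclidean_space\<close>. Measurable sets are those in
  \<open>sets lebesgue\<close>, and balls are open.
\<close>

definition density_one :: "'a::euclidean_space set \<Rightarrow> 'a set" where
  "density_one E = {x. ((\<lambda>\<rho>. measure lebesgue (E \<inter> ball x \<rho>) / measure lebesgue (ball x \<rho>))
                          \<longlongrightarrow> 1) (at_right 0)}"

definition oplus_ball :: "'a::metric_space set \<Rightarrow> real \<Rightarrow> 'a set" where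
  "oplus_ball A \<rho> = (\<Union>x\<in>A. ball x \<rho>)"

definition Per :: "real \<Rightarrow> 'a::euclidean_space set \<Rightarrow> 'a set \<Rightarrow> ennreal" where
  "Per r E \<Omega> = emeasure lebesgue (oplus_ball (frontier (density_one E)) r \<inter> \<Omega>) / ennreal (2 * r)"

text \<open>
  The integral of \<open>g\<close> over \<open>A\<close> as an extended real: it is the usual integral if \<open>g\<close> is integrable
  on \<open>A\<close>, and \<open>\<plusminus>\<infinity>\<close> if exactly one of the positive and the negative part has infinite integral.
  For \<open>\<Omega> = \<real>\<^sup>n\<close> and \<open>g\<close> merely locally integrable, all of these cases occur. If both parts are
  infinite, or if \<open>\<infinity>\<close> and \<open>-\<infinity>\<close> meet in \<open>energy\<close> below, the mathematical expression has no value;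
  the arithmetic of \<open>ereal\<close> then returns \<open>\<infinity>\<close>.
\<close>

definition ext_integral :: "('a::euclidean_space \<Rightarrow> real) \<Rightarrow> 'a set \<Rightarrow> ereal" where
  "ext_integral g A = enn2ereal (\<integral>\<^sup>+x\<in>A. ennreal (g x) \<partial>lebesgue)
                      - enn2ereal (\<integral>\<^sup>+x\<in>A. ennreal (- g x) \<partial>lebesgue)"

definition energy :: "real \<Rightarrow> ('a::euclidean_space \<Rightarrow> real) \<Rightarrow> 'a set \<Rightarrow> 'a set \<Rightarrow> ereal" where
  "energy r g E \<Omega> = enn2ereal (Per r E \<Omega>) + ext_integral g (E \<inter> \<Omega>)"

text \<open>
  \<open>energy r g _ \<Omega>\<close> is a well-defined functional with values in \<open>(-\<infinity>, \<infinity>]\<close> on all measurable sets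
  exactly when the negative part of \<open>g\<close> is integrable over \<open>\<Omega>\<close>: otherwise there is a set of
  infinite perimeter on which the integral of \<open>g\<close> is \<open>-\<infinity>\<close>. For bounded \<open>\<Omega>\<close> and locally
  integrable \<open>g\<close> this holds automatically (lemma \<open>neg_part_integrable_bounded\<close>).
\<close>

definition neg_part_integrable :: "('a::euclidean_space \<Rightarrow> real) \<Rightarrow> 'a set \<Rightarrow> bool" where
  "neg_part_integrable g \<Omega> \<longleftrightarrow> (\<integral>\<^sup>+x\<in>\<Omega>. ennreal (- g x) \<partial>lebesgue) < \<infinity>"

definition L1_loc :: "'a::euclidean_space set \<Rightarrow> ('a \<Rightarrow> real) set" where
  "L1_loc A = {f. \<forall>K. compact K \<and> K \<subseteq> A \<longrightarrow> set_integrable lebesgue K f}"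

definition L1_loc_conv ::
  "'a::euclidean_space set \<Rightarrow> (nat \<Rightarrow> 'a \<Rightarrow> real) \<Rightarrow> ('a \<Rightarrow> real) \<Rightarrow> bool" where
  "L1_loc_conv A f u \<longleftrightarrow> (\<forall>k. f k \<in> L1_loc A) \<and> u \<in> L1_loc A \<and>
     (\<forall>K. compact K \<and> K \<subseteq> A \<longrightarrow> (\<lambda>k. LINT x:K|lebesgue. \<bar>f k x - u x\<bar>) \<longlonglongrightarrow> 0)"

text \<open>Weak convergence in \<open>L\<^sup>1(K)\<close> for all compact \<open>K\<close>, tested against \<open>L\<^sup>\<infinity>\<close>.\<close>

definition weak_L1_loc_conv ::
  "'a::euclidean_space set \<Rightarrow> (nat \<Rightarrow> 'a \<Rightarrow> real) \<Rightarrow> ('a \<Rightarrow> real) \<Rightarrow> bool" where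
  "weak_L1_loc_conv A f u \<longleftrightarrow> (\<forall>k. f k \<in> L1_loc A) \<and> u \<in> L1_loc A \<and>
     (\<forall>K \<phi>. compact K \<and> K \<subseteq> A \<and> \<phi> \<in> borel_measurable lebesgue \<and> bounded (range \<phi>) \<longrightarrow>
        (\<lambda>k. LINT x:K|lebesgue. f k x * \<phi> x) \<longlonglongrightarrow> (LINT x:K|lebesgue. u x * \<phi> x))"

text \<open>
  \<open>\<Gamma>\<close>-convergence of functionals on measurable subsets of \<open>\<real>\<^sup>n\<close>, with respect to convergence of
  characteristic functions in \<open>L\<^sup>1\<^sub>l\<^sub>o\<^sub>c(A)\<close>.

  Pitfall: the value \<open>Per r E \<Omega>\<close> is determined by \<open>E\<close> on the open set \<open>oplus_ball \<Omega> r\<close>, not on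
  \<open>\<Omega>\<close>, because points of the boundary of \<open>E\<close> outside \<open>\<Omega>\<close> count as well. So for bounded \<open>\<Omega>\<close> the
  perimeter is not a function of the class of \<open>E\<close> in \<open>L\<^sup>1\<^sub>l\<^sub>o\<^sub>c(\<Omega>)\<close>, and \<open>A = \<Omega>\<close> cannot give the
  liminf inequality (take empty \<open>E k\<close>, and as \<open>E\<close> a ball outside \<open>\<Omega>\<close> at distance less than \<open>r\<close>
  from it); the appropriate choice is \<open>A = oplus_ball \<Omega> r\<close>. The same applies to the oscillation
  of a weak limit over balls centered in \<open>\<Omega>\<close>. For \<open>\<Omega> = \<real>\<^sup>n\<close> the two choices of \<open>A\<close> coincide.
\<close>

definition Gamma_conv ::
  "'a::euclidean_space set \<Rightarrow> (nat \<Rightarrow> 'a set \<Rightarrow> 'b::complete_lattice) \<Rightarrow> ('a set \<Rightarrow> 'b) \<Rightarrow> bool" where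
  "Gamma_conv A \<F> \<F>\<^sub>0 \<longleftrightarrow>
     (\<forall>E\<in>sets lebesgue.
        (\<forall>Ek. (\<forall>k. Ek k \<in> sets lebesgue) \<and> L1_loc_conv A (\<lambda>k. indicator (Ek k)) (indicator E)
              \<longrightarrow> \<F>\<^sub>0 E \<le> liminf (\<lambda>k. \<F> k (Ek k))) \<and>
        (\<exists>Ek. (\<forall>k. Ek k \<in> sets lebesgue) \<and> L1_loc_conv A (\<lambda>k. indicator (Ek k)) (indicator E)
              \<and> limsup (\<lambda>k. \<F> k (Ek k)) \<le> \<F>\<^sub>0 E))"

definition ess_sup_on :: "'a::euclidean_space set \<Rightarrow> ('a \<Rightarrow> real) \<Rightarrow> ereal" where
  "ess_sup_on A u = esssup (restrict_space lebesgue A) (\<lambda>y. ereal (u y))"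

definition ess_inf_on :: "'a::euclidean_space set \<Rightarrow> ('a \<Rightarrow> real) \<Rightarrow> ereal" where
  "ess_inf_on A u = - ess_sup_on A (\<lambda>y. - u y)"

definition osc :: "'a::euclidean_space set \<Rightarrow> ('a \<Rightarrow> real) \<Rightarrow> ereal" where
  "osc A u = ess_sup_on A u - ess_inf_on A u"

lemma oplus_ball_UNIV: "r > 0 \<Longrightarrow> oplus_ball UNIV r = UNIV"
  by (auto simp: oplus_ball_def)

lemma neg_part_integrable_bounded:
  assumes "bounded \<Omega>" "g \<in> L1_loc UNIV"
  shows "neg_part_integrable g \<Omega>"
proof -
  let ?K = "closure \<Omega>"
  have "compact ?K" using assms(1) by (simp add: compact_closure)
  then have i: "integrable lebesgue (\<lambda>x. indicator ?K x *\<^sub>R g x)"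
    using assms(2) by (simp add: L1_loc_def set_integrable_def)
  have "(\<integral>\<^sup>+x\<in>\<Omega>. ennreal (- g x) \<partial>lebesgue) \<le> (\<integral>\<^sup>+x. ennreal (norm (indicator ?K x *\<^sub>R g x)) \<partial>lebesgue)"
    using closure_subset[of \<Omega>]
    by (intro nn_integral_mono) (auto simp: indicator_def intro!: ennreal_leI)
  also have "\<dots> < \<infinity>" using i by (simp add: integrable_iff_bounded)
  finally show ?thesis by (simp add: neg_part_integrable_def)
qed

end

theory Submission
  imports Defs
begin

text \<open>
  The perimeter charges the open set of points at distance less than \<open>r\<close> from
  \<open>\<partial>E\<close>, the topological boundary of the density-one set of \<open>E\<close>. What makes it tractable is
  that \<open>\<partial>E\<close> can be located by measuring volumes: every ball around a point of \<open>\<partial>E\<close> meets both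
  \<open>E\<close> and its complement in positive measure (\<open>frontier_density_one_ball\<close>), and every
  connected set that meets both in positive measure must meet \<open>\<partial>E\<close>
  (\<open>frontier_density_one_meets\<close>). The second half rests on
  Lebesgue's density theorem, proved here from the Vitali covering theorem.

  Suppose now that the characteristic functions of \<open>E\<^sub>k\<close> converge, even only weakly, to
  \<open>u\<close> with values in \<open>[0, 1]\<close>. If on some ball \<open>u\<close> is neither almost everywhere \<open>0\<close> nor almost
  everywhere \<open>1\<close>, then its integral over the ball is strictly between \<open>0\<close> and the volume,
  so the volume fraction of \<open>E\<^sub>k\<close> is eventually strictly between \<open>0\<close> and \<open>1\<close>, and
  \<open>\<partial>E\<^sub>k\<close> eventually meets the ball (\<open>weak_limit_frontier_meets_ball\<close>). Hence a point \<open>x\<close>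
  at distance less than \<open>r\<close> from such a ball eventually belongs to the \<open>r\<^sub>k\<close>-neighbourhood
  of \<open>\<partial>E\<^sub>k\<close>, and Fatou's lemma bounds the measure of all such \<open>x\<close> by
  \<open>2 r liminf Per\<close> (\<open>nn_integral_le_liminf_Per\<close>). This one estimate gives three of the claims:
  the liminf inequality (small balls around points of \<open>\<partial>E\<close>), the bound on the neighbourhood of
  \<open>\<Sigma>\<close> (small balls around density points of \<open>{0 < u < 1}\<close>), and the oscillation bound (balls
  of radius slightly less than \<open>r\<close>, on which \<open>u\<close> is not constant; the oscillation is at most \<open>1\<close>).

  For a fixed set the perimeter is continuous in the radius because the level set
  \<open>{x. dist(x, \<partial>E) = r}\<close> is null: at each of its points it misses a ball of comparable size, so it
  has no density points. With \<open>\<Omega> = \<real>\<^sup>n\<close> the neighbourhoods have infinite measure for every radius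
  if \<open>\<partial>E\<close> is unbounded, and lie in a common ball otherwise. So constant sequences are
  recovery sequences. The energies follow since \<open>E \<mapsto> \<integral>\<^sub>E f\<close> is lower semicontinuous for
  every measurable \<open>f \<ge> 0\<close>; the negative part of \<open>g\<close> is handled by passing to complements.

  Off \<open>\<Sigma>\<close> the limit \<open>u\<close> takes only the values \<open>0\<close> and \<open>1\<close>, where
  \<open>|\<chi> - u| = \<chi> (1 - 2 u) + u\<close> for any \<open>\<chi> \<in> {0, 1}\<close>; this is affine in \<open>\<chi>\<close>, so weak convergence
  already implies strong convergence.
\<close>

section \<open>Lebesgue's density theorem\<close>

lemma negligible_iff_emeasure:
  "negligible S \<longleftrightarrow> S \<in> sets lebesgue \<and> emeasure lebesgue S = 0"
  by (auto simp: negligible_iff_null_sets null_sets_def)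

lemma emeasure_lebesgue_ball_finite: "emeasure lebesgue (ball x d) < \<infinity>"
  using lmeasurable_ball[of x d] by (auto simp: fmeasurable_def)

lemma emeasure_lebesgue_ball_pos: "0 < d \<Longrightarrow> 0 < emeasure lebesgue (ball x d)"
  using open_not_negligible[of "ball x d"] negligible_iff_emeasure[of "ball x d"]
  by (auto simp: zero_less_iff_neq_zero)

text \<open>
  Cover \<open>A\<close>, up to a null set, by disjoint small balls contained in an open set \<open>U\<close> whose measure
  barely exceeds the outer measure \<open>m\<close> of \<open>A\<close>. Summing the hypothesis over these balls gives
  \<open>m \<le> c |U|\<close>, hence \<open>m \<le> c m\<close>, so \<open>m = 0\<close>. The set \<open>A\<close> need not be measurable, whence the outer
  measure; the enclosing measurable set \<open>S\<close> makes the sum over the balls meaningful.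
\<close>

lemma negligible_if_sparse_bounded:
  fixes A S :: "'a::euclidean_space set"
  assumes S: "S \<in> sets lebesgue" and A: "A \<subseteq> S" "bounded A" and c: "0 \<le> c" "c < 1"
    and sparse: "\<And>x \<epsilon>. x \<in> A \<Longrightarrow> 0 < \<epsilon> \<Longrightarrow> \<exists>d>0. d < \<epsilon> \<and>
        emeasure lebesgue (S \<inter> ball x d) \<le> ennreal c * emeasure lebesgue (ball x d)"
  shows "negligible A"
proof -
  define m where "m = outer_measure_of lebesgue A"
  obtain H where H: "H \<in> sets lebesgue" "A \<subseteq> H" "m = emeasure lebesgue H"
    using outer_measure_of_attain[of A lebesgue] by (auto simp: m_def)
  obtain R where R: "A \<subseteq> ball 0 R"
    using A(2) bounded_subset_ballD by blast
  have "m \<le> emeasure lebesgue (ball 0 R :: 'a set)"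
    unfolding m_def using outer_measure_of_mono[OF R, of lebesgue] by simp
  then have fin: "m < \<infinity>"
    using emeasure_lebesgue_ball_finite[of 0 R] le_less_trans by blast
  have bound: "m \<le> ennreal c * (m + ennreal e)" if e: "e > 0" for e
  proof -
    obtain U where U: "open U" "H \<subseteq> U" "U - H \<in> lmeasurable" "emeasure lebesgue (U - H) < ennreal e"
      using sets_lebesgue_outer_open[OF H(1) e] .
    define K where "K = {(x, d). x \<in> A \<and> 0 < d \<and> ball x d \<subseteq> U \<and>
        emeasure lebesgue (S \<inter> ball x d) \<le> ennreal c * emeasure lebesgue (ball x d)}"
    have "\<exists>i. i \<in> K \<and> x \<in> ball (fst i) (snd i) \<and> snd i < d" if "x \<in> A" "0 < d" for x d
    proof -
      obtain \<delta> where "\<delta> > 0" "ball x \<delta> \<subseteq> U"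
        using U(1,2) H(2) \<open>x \<in> A\<close> by (meson open_contains_ball subsetD)
      moreover obtain d' where "d' > 0" "d' < min \<delta> d"
        "emeasure lebesgue (S \<inter> ball x d') \<le> ennreal c * emeasure lebesgue (ball x d')"
        using sparse[OF \<open>x \<in> A\<close>, of "min \<delta> d"] \<open>\<delta> > 0\<close> \<open>0 < d\<close> by auto
      ultimately have "(x, d') \<in> K"
        using \<open>x \<in> A\<close> by (force simp: K_def)
      then show ?thesis
        using \<open>d' > 0\<close> \<open>d' < min \<delta> d\<close> by force
    qed
    then obtain C where C: "countable C" "C \<subseteq> K"
      "pairwise (\<lambda>i j. disjnt (ball (fst i) (snd i)) (ball (fst j) (snd j))) C"
      "negligible (A - (\<Union>i\<in>C. ball (fst i) (snd i)))"
      using Vitali_covering_theorem_balls[of A K fst snd] by blast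
    define B where "B i = ball (fst i) (snd i)" for i :: "'a \<times> real"
    have disj: "disjoint_family_on B C"
      using C(3) by (auto simp: disjoint_family_on_def pairwise_def disjnt_def B_def)
    have Bm: "B i \<in> sets lebesgue" for i
      by (simp add: B_def)
    have SBm: "S \<inter> B i \<in> sets lebesgue" for i
      using S Bm by auto
    let ?N = "A - (\<Union>i\<in>C. B i)"
    have N: "?N \<in> null_sets lebesgue"
      using C(4) by (simp add: B_def negligible_iff_null_sets)
    have USB: "(\<Union>i\<in>C. S \<inter> B i) \<in> sets lebesgue"
      using C(1) SBm by blast
    have "m \<le> outer_measure_of lebesgue ((\<Union>i\<in>C. S \<inter> B i) \<union> ?N)"
      unfolding m_def using A(1) by (intro outer_measure_of_mono) auto
    also have "\<dots> = emeasure lebesgue ((\<Union>i\<in>C. S \<inter> B i) \<union> ?N)"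
      using USB N by (intro outer_measure_of_eq) auto
    also have "\<dots> = emeasure lebesgue (\<Union>i\<in>C. S \<inter> B i)"
      by (rule emeasure_Un_null_set[OF USB N])
    also have "\<dots> = (\<integral>\<^sup>+i. emeasure lebesgue (S \<inter> B i) \<partial>count_space C)"
    proof (rule emeasure_UN_countable)
      show "disjoint_family_on (\<lambda>i. S \<inter> B i) C"
        using disj unfolding disjoint_family_on_def by blast
    qed (use SBm C(1) in auto)
    also have "\<dots> \<le> (\<integral>\<^sup>+i. ennreal c * emeasure lebesgue (B i) \<partial>count_space C)"
      using C(2) by (intro nn_integral_mono) (auto simp: K_def B_def)
    also have "\<dots> = ennreal c * (\<integral>\<^sup>+i. emeasure lebesgue (B i) \<partial>count_space C)"
      by (rule nn_integral_cmult) simp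
    also have "\<dots> = ennreal c * emeasure lebesgue (\<Union>i\<in>C. B i)"
      using disj Bm C(1) by (subst emeasure_UN_countable) auto
    also have "\<dots> \<le> ennreal c * emeasure lebesgue (H \<union> (U - H))"
    proof (intro mult_left_mono emeasure_mono)
      show "(\<Union>i\<in>C. B i) \<subseteq> H \<union> (U - H)"
        using C(2) by (force simp: K_def B_def)
    qed (use H(1) U(1,2) in \<open>auto simp: Un_absorb1\<close>)
    also have "\<dots> \<le> ennreal c * (emeasure lebesgue H + emeasure lebesgue (U - H))"
      using H(1) U(3) by (intro mult_left_mono emeasure_subadditive) auto
    also have "\<dots> \<le> ennreal c * (m + ennreal e)"
      using U(4) H(3) by (intro mult_left_mono add_mono) auto
    finally show ?thesis .
  qed
  obtain \<mu> where \<mu>: "m = ennreal \<mu>" "\<mu> \<ge> 0"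
    using fin by (cases m) auto
  have "\<mu> \<le> c * \<mu> + e" if "e > 0" for e
  proof -
    have "ennreal \<mu> \<le> ennreal (c * (\<mu> + e))"
      using bound[OF that] \<mu> that c by (simp add: ennreal_mult')
    moreover have "c * e \<le> e"
      using c that by (simp add: mult_left_le_one_le)
    moreover have "\<mu> \<le> c * (\<mu> + e)" if "ennreal \<mu> \<le> ennreal (c * (\<mu> + e))"
      using that c \<mu>(2) \<open>e > 0\<close> by (subst (asm) ennreal_le_iff) auto
    ultimately show ?thesis
      by (simp add: distrib_left)
  qed
  then have "\<mu> \<le> c * \<mu>"
    by (rule field_le_epsilon)
  then have "\<mu> = 0"
    using c \<mu>(2) by (simp add: mult_le_cancel_right1)
  then have "negligible H"
    using \<mu> H by (simp add: negligible_iff_emeasure)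
  then show ?thesis
    using H(2) negligible_subset by blast
qed

lemma negligible_if_bounded_parts:
  fixes A :: "'a::euclidean_space set"
  assumes "\<And>n::nat. negligible (A \<inter> ball 0 (real n))"
  shows "negligible A"
proof -
  have "A = (\<Union>n::nat. A \<inter> ball 0 (real n))"
    using reals_Archimedean2 by fastforce
  then show ?thesis
    using negligible_Union_nat[of "\<lambda>n. A \<inter> ball 0 (real n)"] assms by simp
qed

lemma negligible_if_sparse:
  fixes A S :: "'a::euclidean_space set"
  assumes S: "S \<in> sets lebesgue" and A: "A \<subseteq> S" and c: "0 \<le> c" "c < 1"
    and sparse: "\<And>x \<epsilon>. x \<in> A \<Longrightarrow> 0 < \<epsilon> \<Longrightarrow> \<exists>d>0. d < \<epsilon> \<and>
        emeasure lebesgue (S \<inter> ball x d) \<le> ennreal c * emeasure lebesgue (ball x d)"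
  shows "negligible A"
proof (rule negligible_if_bounded_parts)
  fix n :: nat
  show "negligible (A \<inter> ball 0 (real n))"
    by (rule negligible_if_sparse_bounded[OF S _ _ c])
       (use A sparse in \<open>auto intro: bounded_subset[OF bounded_ball]\<close>)
qed

lemma lmeasurable_Int_ball: "E \<in> sets lebesgue \<Longrightarrow> E \<inter> ball x d \<in> lmeasurable"
  by (subst Int_commute) (simp add: fmeasurable_Int_fmeasurable)

text \<open>
  The ratios never exceed \<open>1\<close>, so at an exceptional point they are at most \<open>1 - 1/(n+1)\<close>
  for some \<open>n\<close> and arbitrarily small radii. For each fixed \<open>n\<close> these points form a null set by
  \<open>negligible_if_sparse\<close>.
\<close>

lemma negligible_Diff_density_one:
  fixes E :: "'a::euclidean_space set"
  assumes E: "E \<in> sets lebesgue"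
  shows "negligible (E - density_one E)"
proof -
  define q where "q x \<rho> = measure lebesgue (E \<inter> ball x \<rho>) / measure lebesgue (ball x \<rho>)"
    for x :: 'a and \<rho>
  define A where "A n = {x\<in>E. \<forall>\<epsilon>>0. \<exists>d>0. d < \<epsilon> \<and> q x d \<le> 1 - inverse (real (Suc n))}" for n
  have q1: "q x \<rho> \<le> 1" for x \<rho>
    unfolding q_def using measure_mono_fmeasurable[of "E \<inter> ball x \<rho>" "ball x \<rho>" lebesgue] E
    by (auto simp: divide_le_eq_1 measure_nonneg less_le)
  have "negligible (A n)" for n
  proof (rule negligible_if_sparse[OF E, where c = "1 - inverse (real (Suc n))"])
    fix x \<epsilon> assume "x \<in> A n" "0 < (\<epsilon>::real)"
    then obtain d where d: "d > 0" "d < \<epsilon>" "q x d \<le> 1 - inverse (real (Suc n))"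
      by (auto simp: A_def)
    then have "measure lebesgue (E \<inter> ball x d)
        \<le> (1 - inverse (real (Suc n))) * measure lebesgue (ball x d)"
      by (simp add: q_def pos_divide_le_eq content_ball_pos)
    then have "emeasure lebesgue (E \<inter> ball x d)
        \<le> ennreal (1 - inverse (real (Suc n))) * emeasure lebesgue (ball x d)"
      using lmeasurable_Int_ball[OF E]
      by (subst (1 2) emeasure_eq_measure2)
         (auto simp: ennreal_mult'[symmetric] inverse_le_1_iff intro!: ennreal_leI)
    then show "\<exists>d>0. d < \<epsilon> \<and> emeasure lebesgue (E \<inter> ball x d)
        \<le> ennreal (1 - inverse (real (Suc n))) * emeasure lebesgue (ball x d)"
      using d by blast
  qed (auto simp: A_def inverse_le_1_iff)
  then have "negligible (\<Union>n. A n)"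
    by (rule negligible_Union_nat)
  moreover have "E - density_one E \<subseteq> (\<Union>n. A n)"
  proof
    fix x assume x: "x \<in> E - density_one E"
    show "x \<in> (\<Union>n. A n)"
    proof (rule ccontr)
      assume "x \<notin> (\<Union>n. A n)"
      then have *: "\<exists>\<epsilon>>0. \<forall>d. 0 < d \<longrightarrow> d < \<epsilon> \<longrightarrow> q x d > 1 - inverse (real (Suc n))" for n
        using x by (force simp: A_def not_le)
      have "(q x \<longlongrightarrow> 1) (at_right 0)"
      proof (rule order_tendstoI)
        fix a :: real assume "a < 1"
        then obtain n where "inverse (real (Suc n)) < 1 - a"
          using reals_Archimedean[of "1 - a"] by auto
        then show "\<forall>\<^sub>F \<rho> in at_right 0. a < q x \<rho>"
          using *[of n] by (force simp: eventually_at_right_field)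
      next
        fix a :: real assume "1 < a"
        then show "\<forall>\<^sub>F \<rho> in at_right 0. q x \<rho> < a"
          using q1 by (intro always_eventually) (auto intro: le_less_trans)
      qed
      then show False
        using x by (simp add: density_one_def q_def[abs_def])
    qed
  qed
  ultimately show ?thesis
    using negligible_subset by blast
qed

section \<open>The boundary of the density-one set\<close>

lemma density_one_ball_not_negligible:
  assumes "x \<in> density_one E" "0 < e"
  shows "\<not> negligible (E \<inter> ball x e)"
proof
  assume neg: "negligible (E \<inter> ball x e)"
  have "\<forall>\<^sub>F \<rho> in at_right 0. 0 < measure lebesgue (E \<inter> ball x \<rho>) / measure lebesgue (ball x \<rho>)"
    using assms(1) unfolding density_one_def mem_Collect_eq by (rule order_tendstoD) simp
  moreover have "\<forall>\<^sub>F \<rho> in at_right 0. \<rho> < e"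
    using eventually_at_right_real[OF assms(2)] by eventually_elim simp
  ultimately have "\<forall>\<^sub>F \<rho> in at_right (0::real). False"
  proof eventually_elim
    case (elim \<rho>)
    then have "negligible (E \<inter> ball x \<rho>)"
      using neg by (auto intro: negligible_subset)
    then show False
      using elim by (simp add: negligible_imp_measure0)
  qed
  then show False
    by simp
qed

lemma ball_subset_density_one:
  fixes E :: "'a::euclidean_space set"
  assumes "negligible (ball x e - E)"
  shows "ball x e \<subseteq> density_one E"
proof
  fix y assume "y \<in> ball x e"
  then obtain \<delta> where \<delta>: "\<delta> > 0" "ball y \<delta> \<subseteq> ball x e"
    using open_contains_ball open_ball by blast
  have "\<forall>\<^sub>F \<rho> in at_right (0::real).
      measure lebesgue (E \<inter> ball y \<rho>) / measure lebesgue (ball y \<rho>) = 1"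
  proof -
    have "measure lebesgue (E \<inter> ball y \<rho>) / measure lebesgue (ball y \<rho>) = 1"
      if "0 < \<rho>" "\<rho> < \<delta>" for \<rho>
    proof -
      have "negligible (ball y \<rho> - E \<union> (E \<inter> ball y \<rho> - ball y \<rho>))"
        using \<delta> that by (intro negligible_subset[OF assms]) auto
      then have "negligible (sym_diff (ball y \<rho>) (E \<inter> ball y \<rho>))"
        by (rule negligible_subset) auto
      then have "measure lebesgue (E \<inter> ball y \<rho>) = measure lebesgue (ball y \<rho>)"
        using measure_negligible_symdiff[of "ball y \<rho>" "E \<inter> ball y \<rho>"] by simp
      then show ?thesis
        using content_ball_pos[OF that(1), of y] by simp
    qed
    then show ?thesis
      using eventually_at_right_real[OF \<delta>(1)] by (auto elim: eventually_mono)
  qed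
  then show "y \<in> density_one E"
    unfolding density_one_def by (simp add: tendsto_eventually)
qed

text \<open>
  The two density ratios add up to \<open>1\<close>, so they cannot both tend to \<open>1\<close>.
\<close>

lemma density_one_Compl_disjoint:
  fixes E :: "'a::euclidean_space set"
  assumes E: "E \<in> sets lebesgue" and x: "x \<in> density_one E"
  shows "x \<notin> density_one (- E)"
proof
  assume "x \<in> density_one (- E)"
  then have "((\<lambda>\<rho>. measure lebesgue (E \<inter> ball x \<rho>) / measure lebesgue (ball x \<rho>)
      + measure lebesgue (- E \<inter> ball x \<rho>) / measure lebesgue (ball x \<rho>)) \<longlongrightarrow> 1 + 1) (at_right 0)"
    using x by (intro tendsto_add) (auto simp: density_one_def)
  moreover have "\<forall>\<^sub>F \<rho> in at_right 0. measure lebesgue (E \<inter> ball x \<rho>) / measure lebesgue (ball x \<rho>)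
      + measure lebesgue (- E \<inter> ball x \<rho>) / measure lebesgue (ball x \<rho>) = (1::real)"
  proof -
    have "measure lebesgue (E \<inter> ball x \<rho>) + measure lebesgue (- E \<inter> ball x \<rho>)
        = measure lebesgue (ball x \<rho>)" if "0 < \<rho>" for \<rho>
    proof -
      have "- E \<in> sets lebesgue"
        using E by (simp add: Compl_in_sets_lebesgue)
      then have "measure lebesgue ((E \<inter> ball x \<rho>) \<union> (- E \<inter> ball x \<rho>))
          = measure lebesgue (E \<inter> ball x \<rho>) + measure lebesgue (- E \<inter> ball x \<rho>)
            - measure lebesgue ((E \<inter> ball x \<rho>) \<inter> (- E \<inter> ball x \<rho>))"
        by (intro measure_Un3 lmeasurable_Int_ball E)
      moreover have "(E \<inter> ball x \<rho>) \<inter> (- E \<inter> ball x \<rho>) = {}"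
        by auto
      moreover have "(E \<inter> ball x \<rho>) \<union> (- E \<inter> ball x \<rho>) = ball x \<rho>"
        by auto
      ultimately show ?thesis
        by simp
    qed
    then have "measure lebesgue (E \<inter> ball x \<rho>) / measure lebesgue (ball x \<rho>)
      + measure lebesgue (- E \<inter> ball x \<rho>) / measure lebesgue (ball x \<rho>) = (1::real)"
      if "0 < \<rho>" for \<rho>
      using that content_ball_pos[OF that, of x] by (simp add: add_divide_distrib[symmetric])
    then show ?thesis
      using eventually_at_right_less[of "0::real"] by (auto elim: eventually_mono)
  qed
  ultimately have "((\<lambda>\<rho>::real. 1::real) \<longlongrightarrow> 1 + 1) (at_right 0)"
    using Lim_transform_eventually by fastforce
  then show False
    by (simp add: tendsto_const_iff)
qed

lemma Int_density_one_nonempty: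
  fixes E :: "'a::euclidean_space set"
  assumes "E \<in> sets lebesgue" "\<not> negligible (E \<inter> B)"
  shows "E \<inter> B \<inter> density_one E \<noteq> {}"
proof
  assume "E \<inter> B \<inter> density_one E = {}"
  then have "E \<inter> B \<subseteq> E - density_one E"
    by auto
  then show False
    using assms(2) negligible_subset[OF negligible_Diff_density_one[OF assms(1)]] by blast
qed

text \<open>
  By the density theorem \<open>B\<close> contains a density-one point of \<open>E\<close> and one of the complement; the
  latter is not a density-one point of \<open>E\<close>. A connected set joining the two crosses the boundary.
\<close>

lemma frontier_density_one_meets:
  fixes E :: "'a::euclidean_space set"
  assumes E: "E \<in> sets lebesgue" and "connected B"
    and "\<not> negligible (E \<inter> B)" "\<not> negligible (B - E)"
  shows "B \<inter> frontier (density_one E) \<noteq> {}"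
proof (rule connected_Int_frontier)
  show "B \<inter> density_one E \<noteq> {}"
    using Int_density_one_nonempty[OF E assms(3)] by auto
  have "- E \<in> sets lebesgue"
    using E by (simp add: Compl_in_sets_lebesgue)
  moreover have "\<not> negligible (- E \<inter> B)"
    using assms(4) by (metis Diff_eq Int_commute)
  ultimately show "B - density_one E \<noteq> {}"
    using Int_density_one_nonempty[of "- E" B] density_one_Compl_disjoint[OF E]
    by (metis Diff_iff Int_iff equals0I)
qed fact

text \<open>
  If \<open>E\<close> had full measure in the ball, the whole ball would consist of density-one points and its
  center would be interior.
\<close>

lemma frontier_density_one_ball:
  fixes E :: "'a::euclidean_space set"
  assumes "x \<in> frontier (density_one E)" "0 < e"
  shows "\<not> negligible (E \<inter> ball x e)" "\<not> negligible (ball x e - E)"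
proof -
  have meets: "ball x e \<inter> density_one E \<noteq> {}" "ball x e - density_one E \<noteq> {}"
    using assms(1)[unfolded frontier_straddle, rule_format, OF assms(2)] by force+
  then obtain y where y: "y \<in> ball x e" "y \<in> density_one E"
    by auto
  then obtain \<delta> where \<delta>: "\<delta> > 0" "ball y \<delta> \<subseteq> ball x e"
    using open_contains_ball open_ball by blast
  show "\<not> negligible (E \<inter> ball x e)"
    using density_one_ball_not_negligible[OF y(2) \<delta>(1)] \<delta>(2)
    by (meson Int_mono negligible_subset order_refl)
  show "\<not> negligible (ball x e - E)"
    using ball_subset_density_one meets(2) by blast
qed

section \<open>Lower bounds for perimeters along sequences\<close>

lemma mem_oplus_ball: "x \<in> oplus_ball F \<rho> \<longleftrightarrow> F \<inter> ball x \<rho> \<noteq> {}"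
  by (auto simp: oplus_ball_def dist_commute)

lemma open_oplus_ball: "open (oplus_ball F \<rho>)"
  by (auto simp: oplus_ball_def)

lemma oplus_ball_Int_sets_lebesgue:
  "\<Omega> \<in> sets lebesgue \<Longrightarrow> oplus_ball F \<rho> \<inter> \<Omega> \<in> sets lebesgue"
  using open_oplus_ball[of F \<rho>] by (intro sets.Int) auto

lemma emeasure_oplus_ball_eq_Per:
  assumes "0 < r"
  shows "emeasure lebesgue (oplus_ball (frontier (density_one E)) r \<inter> \<Omega>) = ennreal (2 * r) * Per r E \<Omega>"
  using assms mult_divide_eq_ennreal[of "ennreal (2 * r)" "emeasure lebesgue (oplus_ball (frontier (density_one E)) r \<inter> \<Omega>)"]
  by (simp add: Per_def ennreal_times_divide mult.commute)

text \<open>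
  Every point where \<open>f\<close> is nonzero belongs to all but finitely many of the neighbourhoods
  measured by the perimeters, because \<open>rk k\<close> eventually exceeds \<open>r'\<close>. Fatou's lemma then bounds
  the integral by the liminf of \<open>2 r\<^sub>k Per\<close>. Stating this for a function \<open>f\<close> rather than
  a set avoids asking for measurability, which is not obvious for the oscillation.
\<close>

lemma nn_integral_le_liminf_Per:
  fixes f :: "'a::euclidean_space \<Rightarrow> ennreal" and Ek :: "nat \<Rightarrow> 'a set"
  assumes \<Omega>: "\<Omega> \<in> sets lebesgue" and rk: "\<And>k. 0 < rk k" "rk \<longlonglongrightarrow> r" and r: "0 < r"
    and f: "\<And>x. x \<in> \<Omega> \<Longrightarrow> f x \<noteq> 0 \<Longrightarrow> f x \<le> 1 \<and>
      (\<exists>r'<r. \<forall>\<^sub>F k in sequentially. frontier (density_one (Ek k)) \<inter> ball x r' \<noteq> {})"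
  shows "(\<integral>\<^sup>+x\<in>\<Omega>. f x \<partial>lebesgue) \<le> 2 * ennreal r * liminf (\<lambda>k. Per (rk k) (Ek k) \<Omega>)"
proof -
  define G where "G k = oplus_ball (frontier (density_one (Ek k))) (rk k) \<inter> \<Omega>" for k
  define L where "L = liminf (\<lambda>k. Per (rk k) (Ek k) \<Omega>)"
  have Gm: "G k \<in> sets lebesgue" for k
    using \<Omega> by (simp add: G_def oplus_ball_Int_sets_lebesgue)
  have "f x * indicator \<Omega> x \<le> liminf (\<lambda>k. indicator (G k) x)" for x
  proof (cases "x \<in> \<Omega> \<and> f x \<noteq> 0")
    case True
    then obtain r' where r': "r' < r" "f x \<le> 1"
      "\<forall>\<^sub>F k in sequentially. frontier (density_one (Ek k)) \<inter> ball x r' \<noteq> {}"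
      using f[of x] by auto
    have "\<forall>\<^sub>F k in sequentially. r' < rk k"
      using rk(2) r'(1) by (rule order_tendstoD)
    with r'(3) have "\<forall>\<^sub>F k in sequentially. 1 \<le> (indicator (G k) x :: ennreal)"
    proof eventually_elim
      case (elim k)
      then have "frontier (density_one (Ek k)) \<inter> ball x (rk k) \<noteq> {}"
        using subset_ball[of r' "rk k" x] by force
      then have "x \<in> G k"
        using True by (simp add: G_def mem_oplus_ball)
      then show ?case
        by simp
    qed
    then have "1 \<le> liminf (\<lambda>k. indicator (G k) x :: ennreal)"
      by (rule Liminf_bounded)
    then show ?thesis
      using True r'(2) by (auto intro: order_trans)
  qed auto
  then have "(\<integral>\<^sup>+x\<in>\<Omega>. f x \<partial>lebesgue) \<le> (\<integral>\<^sup>+x. liminf (\<lambda>k. indicator (G k) x) \<partial>lebesgue)"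
    by (intro nn_integral_mono)
  also have "\<dots> \<le> liminf (\<lambda>k. \<integral>\<^sup>+x. indicator (G k) x \<partial>lebesgue)"
    using Gm by (intro nn_integral_liminf) auto
  also have "\<dots> = liminf (\<lambda>k. ennreal (2 * rk k) * Per (rk k) (Ek k) \<Omega>)"
    using Gm rk(1) by (simp add: G_def emeasure_oplus_ball_eq_Per del: emeasure_completion)
  finally have X: "(\<integral>\<^sup>+x\<in>\<Omega>. f x \<partial>lebesgue) \<le> \<dots>" .
  have Y: "(\<integral>\<^sup>+x\<in>\<Omega>. f x \<partial>lebesgue) \<le> ennreal (2 * (r + inverse (real (Suc n)))) * L" for n
  proof -
    let ?c = "ennreal (2 * (r + inverse (real (Suc n))))"
    have "\<forall>\<^sub>F k in sequentially. rk k < r + inverse (real (Suc n))"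
      using rk(2) by (rule order_tendstoD) simp
    then have "\<forall>\<^sub>F k in sequentially. ennreal (2 * rk k) * Per (rk k) (Ek k) \<Omega> \<le> ?c * Per (rk k) (Ek k) \<Omega>"
      by eventually_elim (intro mult_right_mono ennreal_leI, auto)
    then have "liminf (\<lambda>k. ennreal (2 * rk k) * Per (rk k) (Ek k) \<Omega>)
        \<le> liminf (\<lambda>k. ?c * Per (rk k) (Ek k) \<Omega>)"
      by (rule Liminf_mono)
    also have "\<dots> = ?c * L"
      unfolding L_def
      by (intro Liminf_compose_continuous_mono ennreal_continuous_on_cmult continuous_on_id)
         (auto simp: mono_def mult_left_mono)
    finally show ?thesis
      using X by simp
  qed
  show ?thesis
  proof (cases "L = top")
    case True
    then show ?thesis
      using r by (simp add: L_def[symmetric] ennreal_mult_top)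
  next
    case False
    then obtain l where l: "L = ennreal l" "l \<ge> 0"
      by (cases L) auto
    have "(\<lambda>n. ennreal (2 * (r + inverse (real (Suc n))) * l)) \<longlonglongrightarrow> ennreal (2 * (r + 0) * l)"
      by (intro tendsto_intros LIMSEQ_inverse_real_of_nat)
    moreover have "(\<integral>\<^sup>+x\<in>\<Omega>. f x \<partial>lebesgue) \<le> ennreal (2 * (r + inverse (real (Suc n))) * l)" for n
      using Y[of n] l r by (simp add: ennreal_mult')
    ultimately have "(\<integral>\<^sup>+x\<in>\<Omega>. f x \<partial>lebesgue) \<le> ennreal (2 * (r + 0) * l)"
      by (intro LIMSEQ_le_const) auto
    then show ?thesis
      using l r by (simp add: L_def[symmetric] ennreal_mult')
  qed
qed

lemma AE_imp_negligible:
  assumes "AE x in lebesgue. P x"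
  shows "negligible {x. \<not> P x}"
proof -
  obtain N where N: "{x \<in> space lebesgue. \<not> P x} \<subseteq> N" "emeasure lebesgue N = 0" "N \<in> sets lebesgue"
    by (rule AE_E[OF assms])
  then have "negligible N"
    by (simp add: negligible_iff_emeasure del: emeasure_completion)
  then show ?thesis
    by (rule negligible_subset) (use N(1) in simp)
qed

lemma negligible_imp_AE:
  assumes "negligible {x. \<not> P x}"
  shows "AE x in lebesgue. P x"
  using assms by (intro AE_I'[of "{x. \<not> P x}"]) (auto simp: negligible_iff_null_sets)

text \<open>
  Testing with the characteristic function of the ball shows that the volumes of \<open>Ek k\<close> in the
  ball converge to the integral \<open>I\<close> of \<open>u\<close>, and the two assumptions of nontriviality say exactly that
  \<open>I\<close> is neither \<open>0\<close> nor the volume of the ball.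
\<close>

lemma weak_limit_frontier_meets_ball:
  fixes Ek :: "nat \<Rightarrow> 'a::euclidean_space set"
  assumes weak: "weak_L1_loc_conv A (\<lambda>k. indicator (Ek k)) u"
    and Ek: "\<And>k. Ek k \<in> sets lebesgue"
    and u: "\<And>x. 0 \<le> u x" "\<And>x. u x \<le> 1" and cb: "cball x e \<subseteq> A"
    and ne: "\<not> negligible {y\<in>ball x e. u y \<noteq> 0}" "\<not> negligible {y\<in>ball x e. u y \<noteq> 1}"
  shows "\<forall>\<^sub>F k in sequentially. frontier (density_one (Ek k)) \<inter> ball x e \<noteq> {}"
proof -
  let ?B = "ball x e"
  define I where "I = (LINT y|lebesgue. indicator ?B y * u y)"
  have ib: "integrable lebesgue (\<lambda>y. indicator ?B y :: real)"
    using lmeasurable_ball[of x e] by (simp add: fmeasurable_def)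
  have "set_integrable lebesgue (cball x e) u"
    using weak cb by (auto simp: weak_L1_loc_conv_def L1_loc_def)
  then have "set_integrable lebesgue ?B u"
    by (rule set_integrable_subset) auto
  then have iu: "integrable lebesgue (\<lambda>y. indicator ?B y * u y)"
    by (simp add: set_integrable_def)
  then have iu': "integrable lebesgue (\<lambda>y. indicator ?B y * (1 - u y))"
    using ib by (simp add: right_diff_distrib)
  have "(\<lambda>k. LINT y:cball x e|lebesgue. indicator (Ek k) y * indicator ?B y)
      \<longlonglongrightarrow> (LINT y:cball x e|lebesgue. u y * indicator ?B y)"
  proof -
    have "bounded (range (indicator ?B :: 'a \<Rightarrow> real))"
      by (auto simp: bounded_iff indicator_def intro!: exI[of _ 1])
    moreover have "(indicator ?B :: 'a \<Rightarrow> real) \<in> borel_measurable lebesgue"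
      by (intro borel_measurable_indicator) simp
    ultimately show ?thesis
      using weak[unfolded weak_L1_loc_conv_def, THEN conjunct2, THEN conjunct2, rule_format,
          of "cball x e" "indicator ?B"] cb compact_cball[of x e] by blast
  qed
  moreover have "(LINT y:cball x e|lebesgue. v y * indicator ?B y)
      = (LINT y|lebesgue. indicator ?B y * v y)" for v :: "'a \<Rightarrow> real"
    unfolding set_lebesgue_integral_def
    by (intro Bochner_Integration.integral_cong) (auto simp: indicator_def)
  moreover have "(LINT y|lebesgue. indicator ?B y * indicator (Ek k) y) = measure lebesgue (Ek k \<inter> ?B)" for k
    using Ek[of k] by (simp add: indicator_inter_arith[symmetric] Int_commute)
  ultimately have lim: "(\<lambda>k. measure lebesgue (Ek k \<inter> ?B)) \<longlonglongrightarrow> I"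
    by (simp add: I_def)
  have "I \<noteq> 0"
  proof
    assume "I = 0"
    then have "AE y in lebesgue. indicator ?B y * u y = 0"
      unfolding I_def using iu u by (subst (asm) integral_nonneg_eq_0_iff_AE) auto
    then have "negligible {y. indicator ?B y * u y \<noteq> 0}"
      by (rule AE_imp_negligible)
    then show False
      using ne(1) by (elim notE negligible_subset) (auto simp: indicator_def)
  qed
  moreover have "I \<ge> 0"
    unfolding I_def using u by (intro integral_nonneg_AE) auto
  moreover have MI: "(LINT y|lebesgue. indicator ?B y * (1 - u y)) = measure lebesgue ?B - I"
    unfolding I_def right_diff_distrib using ib iu by simp
  have "measure lebesgue ?B - I \<noteq> 0"
  proof
    assume "measure lebesgue ?B - I = 0"
    then have "AE y in lebesgue. indicator ?B y * (1 - u y) = 0"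
      unfolding MI[symmetric] using iu' u by (subst (asm) integral_nonneg_eq_0_iff_AE) auto
    then have "negligible {y. indicator ?B y * (1 - u y) \<noteq> 0}"
      by (rule AE_imp_negligible)
    then show False
      using ne(2) by (elim notE negligible_subset) (auto simp: indicator_def)
  qed
  moreover have "measure lebesgue ?B - I \<ge> 0"
    unfolding MI[symmetric] using u by (intro integral_nonneg_AE) auto
  ultimately have I: "0 < I" "I < measure lebesgue ?B"
    by auto
  from order_tendstoD(1)[OF lim I(1)] order_tendstoD(2)[OF lim I(2)] show ?thesis
  proof eventually_elim
    case (elim k)
    have "\<not> negligible (Ek k \<inter> ?B)"
      using elim(1) negligible_imp_measure0 by force
    moreover have "\<not> negligible (?B - Ek k)"
    proof
      assume "negligible (?B - Ek k)"
      then have "measure lebesgue (Ek k \<inter> ?B) = measure lebesgue ?B"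
        by (intro measure_negligible_symdiff) (auto elim: negligible_subset)
      then show False
        using elim(2) by simp
    qed
    ultimately show ?case
      using frontier_density_one_meets[OF Ek[of k] convex_connected[OF convex_ball]] by blast
  qed
qed

lemma set_integrable_mult_bounded:
  fixes f \<phi> :: "'a::euclidean_space \<Rightarrow> real"
  assumes f: "set_integrable lebesgue K f" and \<phi>: "\<phi> \<in> borel_measurable lebesgue" "\<And>x. \<bar>\<phi> x\<bar> \<le> C"
  shows "set_integrable lebesgue K (\<lambda>x. f x * \<phi> x)"
proof -
  have i: "integrable lebesgue (\<lambda>x. indicator K x * f x)"
    using f by (simp add: set_integrable_def)
  have "integrable lebesgue (\<lambda>x. (indicator K x * f x) * \<phi> x)"
  proof (rule Bochner_Integration.integrable_bound)
    show "integrable lebesgue (\<lambda>x. C * (indicator K x * f x))"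
      using i by simp
    show "(\<lambda>x. indicator K x * f x * \<phi> x) \<in> borel_measurable lebesgue"
      using borel_measurable_integrable[OF i] \<phi>(1) by simp
    show "AE x in lebesgue. norm (indicator K x * f x * \<phi> x) \<le> norm (C * (indicator K x * f x))"
    proof (rule AE_I2)
      fix x
      have "\<bar>\<phi> x\<bar> \<le> \<bar>C\<bar>"
        using \<phi>(2)[of x] by linarith
      then show "norm (indicator K x * f x * \<phi> x) \<le> norm (C * (indicator K x * f x))"
        by (simp add: abs_mult mult.commute[of _ "\<bar>\<phi> x\<bar>"] mult_right_mono)
    qed
  qed
  then show ?thesis
    by (simp add: set_integrable_def mult.assoc)
qed

lemma L1_loc_conv_imp_weak:
  fixes f :: "nat \<Rightarrow> 'a::euclidean_space \<Rightarrow> real"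
  assumes conv: "L1_loc_conv A f u"
  shows "weak_L1_loc_conv A f u"
  unfolding weak_L1_loc_conv_def
proof (intro conjI allI impI)
  show "f k \<in> L1_loc A" for k
    using conv by (simp add: L1_loc_conv_def)
  show "u \<in> L1_loc A"
    using conv by (simp add: L1_loc_conv_def)
  fix K and \<phi> :: "'a \<Rightarrow> real"
  assume *: "compact K \<and> K \<subseteq> A \<and> \<phi> \<in> borel_measurable lebesgue \<and> bounded (range \<phi>)"
  then obtain C where C: "\<And>x. \<bar>\<phi> x\<bar> \<le> C"
    by (auto simp: bounded_iff)
  have fi: "set_integrable lebesgue K (f k)" and ui: "set_integrable lebesgue K u" for k
    using conv * by (auto simp: L1_loc_conv_def L1_loc_def)
  have lim: "(\<lambda>k. C * (LINT x:K|lebesgue. \<bar>f k x - u x\<bar>)) \<longlonglongrightarrow> C * 0"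
    using conv * by (intro tendsto_mult tendsto_const) (auto simp: L1_loc_conv_def)
  have m: "set_integrable lebesgue K (\<lambda>x. v x * \<phi> x)" if "set_integrable lebesgue K v" for v
    using * C that by (intro set_integrable_mult_bounded) auto
  have bound: "\<bar>(LINT x:K|lebesgue. f k x * \<phi> x) - (LINT x:K|lebesgue. u x * \<phi> x)\<bar>
      \<le> C * (LINT x:K|lebesgue. \<bar>f k x - u x\<bar>)" for k
  proof -
    have d: "set_integrable lebesgue K (\<lambda>x. f k x - u x)"
      using fi ui by (rule set_integral_diff)
    have "(LINT x:K|lebesgue. f k x * \<phi> x) - (LINT x:K|lebesgue. u x * \<phi> x)
        = (LINT x:K|lebesgue. f k x * \<phi> x - u x * \<phi> x)"
      using m fi ui by (simp add: set_integral_diff)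
    also have "\<bar>\<dots>\<bar> \<le> (LINT x:K|lebesgue. \<bar>f k x * \<phi> x - u x * \<phi> x\<bar>)"
      using set_integral_norm_bound[of lebesgue K "\<lambda>x. f k x * \<phi> x - u x * \<phi> x"]
        set_integral_diff(1)[OF m[OF fi[of k]] m[OF ui]] by simp
    also have "\<dots> \<le> (LINT x:K|lebesgue. C * \<bar>f k x - u x\<bar>)"
    proof (rule set_integral_mono)
      show "set_integrable lebesgue K (\<lambda>x. \<bar>f k x * \<phi> x - u x * \<phi> x\<bar>)"
        using set_integral_diff(1)[OF m[OF fi[of k]] m[OF ui]] by (rule set_integrable_abs)
      show "set_integrable lebesgue K (\<lambda>x. C * \<bar>f k x - u x\<bar>)"
        using set_integrable_abs[OF d] by (simp add: set_integrable_mult_right)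
      show "\<bar>f k x * \<phi> x - u x * \<phi> x\<bar> \<le> C * \<bar>f k x - u x\<bar>" for x
        using mult_right_mono[OF C[of x] abs_ge_zero[of "f k x - u x"]]
        by (simp add: abs_mult[symmetric] right_diff_distrib mult.commute[of _ "\<phi> x"])
    qed
    finally show ?thesis
      by simp
  qed
  have "(\<lambda>k. (LINT x:K|lebesgue. f k x * \<phi> x) - (LINT x:K|lebesgue. u x * \<phi> x)) \<longlonglongrightarrow> 0"
    by (rule Lim_null_comparison[OF always_eventually]) (use bound lim in auto)
  then show "(\<lambda>k. LINT x:K|lebesgue. f k x * \<phi> x) \<longlonglongrightarrow> (LINT x:K|lebesgue. u x * \<phi> x)"
    by (rule LIM_zero_cancel)
qed

lemma indicator_in_L1_loc:
  "E \<in> sets lebesgue \<Longrightarrow> (indicator E :: 'a::euclidean_space \<Rightarrow> real) \<in> L1_loc A"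
  using fmeasurable_Int_fmeasurable[OF lmeasurable_compact, of _ E]
  by (auto simp: L1_loc_def set_integrable_def fmeasurable_def indicator_inter_arith[symmetric]
      simp del: emeasure_completion intro!: integrable_real_indicator)

text \<open>
  Every small ball around a point of \<open>\<partial>E\<close> is split by \<open>E\<close> into two parts of positive measure, so
  it eventually meets \<open>\<partial>E\<^sub>k\<close>. Convergence is required on the \<open>r\<close>-neighbourhood of \<open>\<Omega>\<close> because
  the boundary point \<open>y\<close> responsible for \<open>x \<in> \<Omega>\<close> may itself lie outside \<open>\<Omega>\<close>.
\<close>

lemma Per_le_liminf:
  fixes Ek :: "nat \<Rightarrow> 'a::euclidean_space set"
  assumes \<Omega>: "\<Omega> \<in> sets lebesgue" and rk: "\<And>k. 0 < rk k" "rk \<longlonglongrightarrow> r" and r: "0 < r"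
    and Ek: "\<And>k. Ek k \<in> sets lebesgue"
    and conv: "L1_loc_conv (oplus_ball \<Omega> r) (\<lambda>k. indicator (Ek k)) (indicator E)"
  shows "Per r E \<Omega> \<le> liminf (\<lambda>k. Per (rk k) (Ek k) \<Omega>)"
proof -
  let ?F = "frontier (density_one E)"
  have "(\<integral>\<^sup>+x\<in>\<Omega>. indicator (oplus_ball ?F r) x \<partial>lebesgue)
      \<le> 2 * ennreal r * liminf (\<lambda>k. Per (rk k) (Ek k) \<Omega>)"
  proof (rule nn_integral_le_liminf_Per[OF \<Omega> rk r], intro conjI)
    fix x assume x: "x \<in> \<Omega>" "indicator (oplus_ball ?F r) x \<noteq> (0::ennreal)"
    then obtain y where y: "y \<in> ?F" "dist x y < r"
      by (auto simp: mem_oplus_ball indicator_def split: if_splits)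
    define e where "e = (r - dist x y) / 2"
    have e: "e > 0" "dist x y + e < r"
      using y(2) by (simp_all add: e_def field_simps)
    have "cball y e \<subseteq> oplus_ball \<Omega> r"
    proof
      fix z assume "z \<in> cball y e"
      then have "dist x z < r"
        using e(2) dist_triangle[of x z y] by simp
      then show "z \<in> oplus_ball \<Omega> r"
        using x(1) by (auto simp: oplus_ball_def)
    qed
    moreover have "{z \<in> ball y e. indicator E z \<noteq> (0::real)} = E \<inter> ball y e"
      "{z \<in> ball y e. indicator E z \<noteq> (1::real)} = ball y e - E"
      by (auto simp: indicator_def)
    ultimately have "\<forall>\<^sub>F k in sequentially. frontier (density_one (Ek k)) \<inter> ball y e \<noteq> {}"
      using frontier_density_one_ball[OF y(1) e(1)] L1_loc_conv_imp_weak[OF conv] Ek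
      by (intro weak_limit_frontier_meets_ball) auto
    moreover have "ball y e \<subseteq> ball x (dist x y + e)"
      by (simp add: ball_subset_ball_iff dist_commute)
    ultimately have "\<forall>\<^sub>F k in sequentially. frontier (density_one (Ek k)) \<inter> ball x (dist x y + e) \<noteq> {}"
      by (elim eventually_mono) blast
    then show "\<exists>r'<r. \<forall>\<^sub>F k in sequentially. frontier (density_one (Ek k)) \<inter> ball x r' \<noteq> {}"
      using e(2) by blast
  qed (simp add: indicator_def)
  also have "(\<integral>\<^sup>+x\<in>\<Omega>. indicator (oplus_ball ?F r) x \<partial>lebesgue) = emeasure lebesgue (oplus_ball ?F r \<inter> \<Omega>)"
    using \<Omega> by (simp add: indicator_inter_arith[symmetric] oplus_ball_Int_sets_lebesgue del: emeasure_completion)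
  finally show ?thesis
    using r unfolding Per_def[of r]
    by (intro divide_le_posI_ennreal)
       (auto simp: ennreal_mult' mult_ac ennreal_zero_less_mult_iff simp del: emeasure_completion)
qed

section \<open>Continuity of the perimeter in the radius\<close>

lemma content_ball_scale:
  fixes x y :: "'a::euclidean_space"
  assumes "0 \<le> d" "0 \<le> t"
  shows "measure lebesgue (ball y (t * d)) = t ^ DIM('a) * measure lebesgue (ball x d)"
  using assms by (simp add: content_ball power_mult_distrib)

text \<open>
  Let \<open>y\<close> be a nearest point of \<open>F\<close> to a point \<open>x\<close> of the level set. The ball of radius \<open>d/2\<close>
  inside \<open>ball x d\<close> that is shifted towards \<open>y\<close> consists of points at distance less than \<open>r\<close>, so the
  level set fills at most the fraction \<open>1 - 2\<^sup>-\<^sup>n\<close> of every small ball around its points.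
\<close>

lemma negligible_infdist_level:
  fixes F :: "'a::euclidean_space set"
  assumes F: "closed F" "F \<noteq> {}" and r: "0 < r"
  shows "negligible {x. infdist x F = r}"
proof -
  define A where "A = {x. infdist x F = r}"
  have "closed A"
    unfolding A_def by (intro closed_Collect_eq continuous_intros)
  then have A: "A \<in> sets lebesgue"
    by simp
  define c :: real where "c = 1 - (1/2) ^ DIM('a)"
  have c: "0 \<le> c" "c < 1"
    by (auto simp: c_def power_le_one)
  have "negligible A"
  proof (rule negligible_if_sparse[OF A order_refl c])
    fix x and \<epsilon> :: real assume x: "x \<in> A" "0 < \<epsilon>"
    obtain y where "y \<in> F" "infdist x F = dist x y"
      by (rule infdist_attains_inf[OF F])
    then have y: "y \<in> F" "dist x y = r"
      using x(1) by (auto simp: A_def)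
    define d where "d = min (\<epsilon> / 2) r"
    have d: "0 < d" "d < \<epsilon>" "d \<le> r"
      using x(2) r by (auto simp: d_def)
    \<comment> \<open>the point at distance \<open>d/2\<close> from \<open>x\<close> on the segment towards \<open>y\<close>\<close>
    define z where "z = x + (d / (2 * r)) *\<^sub>R (y - x)"
    have nxy: "norm (y - x) = r"
      using y(2) by (simp add: dist_norm norm_minus_commute)
    have xz: "dist x z = d / 2"
      using r d nxy by (simp add: z_def dist_norm)
    have "z - y = (1 - d / (2 * r)) *\<^sub>R (x - y)"
      by (simp add: z_def algebra_simps)
    then have zy: "dist z y = r - d / 2"
      using r d y(2) by (simp add: dist_norm) (simp add: field_simps)
    have sub: "ball z (1/2 * d) \<subseteq> ball x d"
      using xz d(1) by (simp add: ball_subset_ball_iff dist_commute)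
    have disj: "A \<inter> ball z (1/2 * d) = {}"
    proof -
      have "infdist w F < r" if "w \<in> ball z (1/2 * d)" for w
      proof -
        have "infdist w F \<le> dist w y"
          using y(1) by (rule infdist_le)
        also have "\<dots> \<le> dist w z + dist z y"
          by (rule dist_triangle)
        also have "\<dots> < r"
          using that zy by (simp add: dist_commute)
        finally show ?thesis .
      qed
      then show ?thesis
        by (force simp: A_def)
    qed
    have "measure lebesgue (A \<inter> ball x d) \<le> measure lebesgue (ball x d - ball z (1/2 * d))"
      using disj lmeasurable_Int_ball[OF A, of x d] fmeasurable_Diff[OF lmeasurable_ball, of "ball z (1/2 * d)" x d]
      by (intro measure_mono_fmeasurable) auto
    also have "\<dots> = measure lebesgue (ball x d) - measure lebesgue (ball z (1/2 * d))"
      using sub by (intro measurable_measure_Diff) auto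
    also have "\<dots> = c * measure lebesgue (ball x d)"
      using content_ball_scale[of d "1/2" z x] d(1) by (simp add: c_def algebra_simps)
    finally have "emeasure lebesgue (A \<inter> ball x d) \<le> ennreal c * emeasure lebesgue (ball x d)"
      using lmeasurable_Int_ball[OF A, of x d] c(1)
      by (simp add: emeasure_eq_measure2 ennreal_mult'[symmetric] ennreal_leI del: emeasure_completion)
    then show "\<exists>d>0. d < \<epsilon> \<and> emeasure lebesgue (A \<inter> ball x d) \<le> ennreal c * emeasure lebesgue (ball x d)"
      using d by blast
  qed
  then show ?thesis
    by (simp add: A_def)
qed

lemma oplus_ball_eq_infdist:
  assumes "closed F" "F \<noteq> {}"
  shows "oplus_ball F \<rho> = {x :: 'a::euclidean_space. infdist x F < \<rho>}"
proof (intro set_eqI iffI)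
  fix x assume "x \<in> oplus_ball F \<rho>"
  then obtain y where "y \<in> F" "dist x y < \<rho>"
    by (auto simp: oplus_ball_def dist_commute)
  then show "x \<in> {x. infdist x F < \<rho>}"
    using infdist_le[of y F x] by simp
next
  fix x assume "x \<in> {x. infdist x F < \<rho>}"
  moreover obtain y where "y \<in> F" "infdist x F = dist x y"
    by (rule infdist_attains_inf[OF assms])
  ultimately show "x \<in> oplus_ball F \<rho>"
    by (auto simp: oplus_ball_def dist_commute)
qed

lemma emeasure_oplus_ball_tendsto:
  fixes F W :: "'a::euclidean_space set"
  assumes F: "closed F" and W: "W \<in> lmeasurable" and r: "0 < r" "rk \<longlonglongrightarrow> r"
  shows "(\<lambda>k. emeasure lebesgue (oplus_ball F (rk k) \<inter> W)) \<longlonglongrightarrow> emeasure lebesgue (oplus_ball F r \<inter> W)"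
proof (cases "F = {}")
  case True
  then show ?thesis
    by (simp add: oplus_ball_def)
next
  case False
  note mem = oplus_ball_eq_infdist[OF F False]
  have m: "oplus_ball F \<rho> \<inter> W \<in> sets lebesgue" for \<rho>
    using W by (intro oplus_ball_Int_sets_lebesgue) auto
  have "(\<lambda>k. \<integral>\<^sup>+x. indicator (oplus_ball F (rk k) \<inter> W) x \<partial>lebesgue)
      \<longlonglongrightarrow> (\<integral>\<^sup>+x. indicator (oplus_ball F r \<inter> W) x \<partial>lebesgue)"
  proof (rule nn_integral_dominated_convergence[where w = "indicator W"])
    show "AE x in lebesgue. (\<lambda>k. indicator (oplus_ball F (rk k) \<inter> W) x :: ennreal)
        \<longlonglongrightarrow> indicator (oplus_ball F r \<inter> W) x"
    proof (rule negligible_imp_AE, rule negligible_subset[OF negligible_infdist_level[OF F False r(1)]])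
      show "{x. \<not> (\<lambda>k. indicator (oplus_ball F (rk k) \<inter> W) x :: ennreal)
          \<longlonglongrightarrow> indicator (oplus_ball F r \<inter> W) x} \<subseteq> {x. infdist x F = r}"
      proof (rule ccontr)
        assume "\<not> ?thesis"
        then obtain x where x: "infdist x F \<noteq> r"
          "\<not> (\<lambda>k. indicator (oplus_ball F (rk k) \<inter> W) x :: ennreal) \<longlonglongrightarrow> indicator (oplus_ball F r \<inter> W) x"
          by auto
        have "\<forall>\<^sub>F k in sequentially. (infdist x F < rk k) = (infdist x F < r)"
        proof (cases "infdist x F < r")
          case True
          from order_tendstoD(1)[OF r(2) True] show ?thesis
            by eventually_elim (use True in auto)
        next
          case False
          then have "r < infdist x F"
            using x(1) by simp
          from order_tendstoD(2)[OF r(2) this] show ?thesis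
            by eventually_elim (use False in auto)
        qed
        then have "\<forall>\<^sub>F k in sequentially. indicator (oplus_ball F (rk k) \<inter> W) x
            = (indicator (oplus_ball F r \<inter> W) x :: ennreal)"
          by eventually_elim (simp add: mem indicator_def)
        then have "(\<lambda>k. indicator (oplus_ball F (rk k) \<inter> W) x :: ennreal)
            \<longlonglongrightarrow> indicator (oplus_ball F r \<inter> W) x"
          by (rule tendsto_eventually)
        then show False
          using x(2) by simp
      qed
    qed
    show "(\<integral>\<^sup>+x. indicator W x \<partial>lebesgue) < \<infinity>"
      using W by (simp add: fmeasurable_def del: emeasure_completion)
  next
    show "(\<lambda>x. indicator (oplus_ball F (rk k) \<inter> W) x) \<in> borel_measurable lebesgue" for k
      using m by (rule borel_measurable_indicator)
    show "(\<lambda>x. indicator (oplus_ball F r \<inter> W) x) \<in> borel_measurable lebesgue"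
      using m by (rule borel_measurable_indicator)
  qed (use W in \<open>auto simp: indicator_def split: if_splits\<close>)
  then show ?thesis
    using m by (simp del: emeasure_completion)
qed

text \<open>
  A set of finite measure has small measure outside a large ball, but far-away points of \<open>F\<close>
  contribute a full ball of radius \<open>r\<close> there.
\<close>

lemma emeasure_oplus_ball_unbounded:
  fixes F :: "'a::euclidean_space set"
  assumes F: "\<not> bounded F" and r: "0 < r"
  shows "emeasure lebesgue (oplus_ball F r) = \<infinity>"
proof (rule ccontr)
  let ?T = "oplus_ball F r"
  assume fin: "emeasure lebesgue ?T \<noteq> \<infinity>"
  have T: "?T \<in> sets lebesgue"
    using open_oplus_ball[of F r] by simp
  define D where "D n = ?T - ball 0 (real n)" for n
  have Dm: "D n \<in> sets lebesgue" for n
    using T unfolding D_def by (intro sets.Diff) auto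
  have "(\<lambda>n. emeasure lebesgue (D n)) \<longlonglongrightarrow> emeasure lebesgue (\<Inter>n. D n)"
  proof (rule Lim_emeasure_decseq)
    show "decseq D"
      by (auto simp: D_def decseq_def)
    show "emeasure lebesgue (D n) \<noteq> \<infinity>" for n
      using fin emeasure_mono[OF _ T, of "D n"]
      by (auto simp: D_def top_unique simp del: emeasure_completion)
  qed (use Dm in auto)
  moreover have "(\<Inter>n. D n) = {}"
    using reals_Archimedean2 by (fastforce simp: D_def)
  ultimately have lim: "(\<lambda>n. emeasure lebesgue (D n)) \<longlonglongrightarrow> 0"
    by simp
  have "emeasure lebesgue (ball (0::'a) r) \<le> emeasure lebesgue (D n)" for n
  proof -
    obtain x where x: "x \<in> F" "real n + r < norm x"
      using F unfolding bounded_iff by (meson not_le)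
    have "ball x r \<subseteq> D n"
    proof
      fix y assume y: "y \<in> ball x r"
      have "norm x \<le> norm y + dist x y"
        by (metis dist_norm norm_triangle_sub)
      then have "real n \<le> norm y"
        using y x(2) by simp
      then show "y \<in> D n"
        using y x(1) by (auto simp: D_def oplus_ball_def)
    qed
    then have "emeasure lebesgue (ball x r) \<le> emeasure lebesgue (D n)"
      using Dm by (intro emeasure_mono)
    moreover have "emeasure lebesgue (ball x r) = emeasure lebesgue (ball (0::'a) r)"
      using r by (simp add: emeasure_ball)
    ultimately show ?thesis
      by simp
  qed
  then have "emeasure lebesgue (ball (0::'a) r) \<le> 0"
    using lim by (intro LIMSEQ_le_const) auto
  then show False
    using emeasure_lebesgue_ball_pos[OF r, of "0::'a"] by simp
qed

lemma Per_tendsto_if_bounded: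
  fixes \<Omega> E :: "'a::euclidean_space set"
  assumes W: "W \<in> lmeasurable"
    and eq: "\<And>\<rho>. \<rho> \<le> R \<Longrightarrow> oplus_ball (frontier (density_one E)) \<rho> \<inter> \<Omega>
      = oplus_ball (frontier (density_one E)) \<rho> \<inter> W"
    and R: "r \<le> R" "\<And>k. rk k \<le> R"
    and r: "0 < r" "rk \<longlonglongrightarrow> r" and rk: "\<And>k. 0 < rk k"
  shows "Per r E \<Omega> < \<infinity>" "(\<lambda>k. Per (rk k) E \<Omega>) \<longlonglongrightarrow> Per r E \<Omega>"
proof -
  let ?F = "frontier (density_one E)"
  have Per: "Per \<rho> E \<Omega> = emeasure lebesgue (oplus_ball ?F \<rho> \<inter> W) * ennreal (inverse (2 * \<rho>))"
    if "0 < \<rho>" "\<rho> \<le> R" for \<rho>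
    using eq[OF that(2)] that(1) by (simp add: Per_def divide_ennreal_def inverse_ennreal)
  have "emeasure lebesgue (oplus_ball ?F r \<inter> W) \<le> emeasure lebesgue W"
    using W by (intro emeasure_mono) auto
  then have fin: "emeasure lebesgue (oplus_ball ?F r \<inter> W) < \<infinity>"
    using W by (auto simp: fmeasurable_def simp del: emeasure_completion)
  then show "Per r E \<Omega> < \<infinity>"
    using r(1) R(1) by (simp add: Per ennreal_mult_less_top del: emeasure_completion)
  have "(\<lambda>k. emeasure lebesgue (oplus_ball ?F (rk k) \<inter> W) * ennreal (inverse (2 * rk k)))
      \<longlonglongrightarrow> emeasure lebesgue (oplus_ball ?F r \<inter> W) * ennreal (inverse (2 * r))"
  proof (rule tendsto_mult_ennreal)
    show "(\<lambda>k. emeasure lebesgue (oplus_ball ?F (rk k) \<inter> W)) \<longlonglongrightarrow> emeasure lebesgue (oplus_ball ?F r \<inter> W)"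
      using W r by (intro emeasure_oplus_ball_tendsto) auto
    show "(\<lambda>k. ennreal (inverse (2 * rk k))) \<longlonglongrightarrow> ennreal (inverse (2 * r))"
      using r by (intro tendsto_intros) auto
  qed (use fin in auto)
  then show "(\<lambda>k. Per (rk k) E \<Omega>) \<longlonglongrightarrow> Per r E \<Omega>"
    using r(1) R rk by (simp add: Per del: emeasure_completion)
qed

text \<open>
  The dichotomy is finer than plain convergence and is what the energies need: if the integral
  of \<open>g\<close> is \<open>-\<infinity>\<close>, the sum depends on whether the perimeter is finite, so this must not change
  along the sequence.
\<close>

lemma Per_infinite_or_tendsto:
  fixes \<Omega> E :: "'a::euclidean_space set"
  assumes \<Omega>: "(open \<Omega> \<and> bounded \<Omega>) \<or> \<Omega> = UNIV" and r: "0 < r" "rk \<longlonglongrightarrow> r" and rk: "\<And>k. 0 < rk k"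
  shows "(\<forall>\<rho>>0. Per \<rho> E \<Omega> = \<infinity>) \<or>
    (Per r E \<Omega> < \<infinity> \<and> (\<lambda>k. Per (rk k) E \<Omega>) \<longlonglongrightarrow> Per r E \<Omega>)"
proof -
  let ?F = "frontier (density_one E)"
  obtain B where B: "\<And>k. \<bar>rk k\<bar> \<le> B"
    using convergent_imp_bounded[OF r(2)] by (auto simp: bounded_iff)
  define R where "R = max B r"
  have R: "r \<le> R" "rk k \<le> R" for k
    using B[of k] by (auto simp: R_def)
  consider "\<Omega> = UNIV" "\<not> bounded ?F" | "bounded \<Omega>" "open \<Omega>" | "\<Omega> = UNIV" "bounded ?F"
    using \<Omega> by blast
  then show ?thesis
  proof cases
    case 1
    then have "Per \<rho> E \<Omega> = \<infinity>" if "\<rho> > 0" for \<rho>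
      using emeasure_oplus_ball_unbounded[of ?F \<rho>] that
      by (simp add: Per_def ennreal_top_divide del: emeasure_completion)
    then show ?thesis
      by blast
  next
    case 2
    then show ?thesis
      using Per_tendsto_if_bounded[OF lmeasurable_open, of \<Omega> R E \<Omega> r rk] R r rk by simp
  next
    case 3
    then obtain S where S: "?F \<subseteq> ball 0 S"
      using bounded_subset_ballD by blast
    have "oplus_ball ?F \<rho> \<inter> \<Omega> = oplus_ball ?F \<rho> \<inter> ball 0 (S + R)" if "\<rho> \<le> R" for \<rho>
    proof -
      have "norm x < S + R" if "y \<in> ?F" "dist y x < \<rho>" for x y
      proof -
        have "norm y < S"
          using S that(1) by auto
        moreover have "norm x \<le> norm y + dist y x"
          by (metis dist_commute dist_norm norm_triangle_sub)
        ultimately show ?thesis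
          using that(2) \<open>\<rho> \<le> R\<close> by linarith
      qed
      then show ?thesis
        using 3(1) by (auto simp: oplus_ball_def)
    qed
    then show ?thesis
      using Per_tendsto_if_bounded[OF lmeasurable_ball, of R E \<Omega> 0 "S + R" r rk] R r rk by simp
  qed
qed

lemma Per_tendsto:
  fixes \<Omega> E :: "'a::euclidean_space set"
  assumes "(open \<Omega> \<and> bounded \<Omega>) \<or> \<Omega> = UNIV" "0 < r" "rk \<longlonglongrightarrow> r" "\<And>k. 0 < rk k"
  shows "(\<lambda>k. Per (rk k) E \<Omega>) \<longlonglongrightarrow> Per r E \<Omega>"
  using Per_infinite_or_tendsto[OF assms(1,2,3), of E] assms(2,4) by auto

lemma energy_tendsto:
  fixes \<Omega> E :: "'a::euclidean_space set"
  assumes "(open \<Omega> \<and> bounded \<Omega>) \<or> \<Omega> = UNIV" "0 < r" "rk \<longlonglongrightarrow> r" "\<And>k. 0 < rk k"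
  shows "(\<lambda>k. energy (rk k) g E \<Omega>) \<longlonglongrightarrow> energy r g E \<Omega>"
proof (cases "\<forall>\<rho>>0. Per \<rho> E \<Omega> = \<infinity>")
  case True
  then have "Per (rk k) E \<Omega> = Per r E \<Omega>" for k
    using assms(2,4) by simp
  then show ?thesis
    by (simp add: energy_def)
next
  case False
  then have *: "Per r E \<Omega> < \<infinity>" "(\<lambda>k. Per (rk k) E \<Omega>) \<longlonglongrightarrow> Per r E \<Omega>"
    using Per_infinite_or_tendsto[OF assms(1,2,3,4), of E] by blast+
  have "(\<lambda>k. ext_integral g (E \<inter> \<Omega>) + enn2ereal (Per (rk k) E \<Omega>))
      \<longlonglongrightarrow> ext_integral g (E \<inter> \<Omega>) + enn2ereal (Per r E \<Omega>)"
  proof (rule tendsto_add_ereal_general1)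
    show "\<bar>enn2ereal (Per r E \<Omega>)\<bar> \<noteq> \<infinity>"
      using *(1) by (cases "Per r E \<Omega>") (auto simp: enn2ereal_ennreal)
    show "(\<lambda>k. enn2ereal (Per (rk k) E \<Omega>)) \<longlonglongrightarrow> enn2ereal (Per r E \<Omega>)"
      using *(2) by (simp add: tendsto_enn2ereal_iff)
  qed simp
  then show ?thesis
    by (simp add: energy_def add.commute)
qed

section \<open>Gamma-convergence\<close>

lemma L1_loc_conv_const: "u \<in> L1_loc A \<Longrightarrow> L1_loc_conv A (\<lambda>k. u) u"
  by (simp add: L1_loc_conv_def set_lebesgue_integral_def)

text \<open>
  Pointwise convergence provides constant recovery sequences.
\<close>

lemma Gamma_convI:
  fixes \<F>\<^sub>0 :: "'a::euclidean_space set \<Rightarrow> 'b::{complete_linorder, linorder_topology}"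
  assumes "\<And>E Ek. E \<in> sets lebesgue \<Longrightarrow> (\<And>k. Ek k \<in> sets lebesgue) \<Longrightarrow>
      L1_loc_conv A (\<lambda>k. indicator (Ek k)) (indicator E) \<Longrightarrow> \<F>\<^sub>0 E \<le> liminf (\<lambda>k. \<F> k (Ek k))"
    and lim: "\<And>E. E \<in> sets lebesgue \<Longrightarrow> (\<lambda>k. \<F> k E) \<longlonglongrightarrow> \<F>\<^sub>0 E"
  shows "Gamma_conv A \<F> \<F>\<^sub>0"
  unfolding Gamma_conv_def
proof (intro ballI conjI allI impI)
  fix E :: "'a set" assume E: "E \<in> sets lebesgue"
  show "\<F>\<^sub>0 E \<le> liminf (\<lambda>k. \<F> k (Ek k))"
    if "(\<forall>k. Ek k \<in> sets lebesgue) \<and> L1_loc_conv A (\<lambda>k. indicator (Ek k)) (indicator E)" for Ek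
    using assms(1)[OF E] that by blast
  have "limsup (\<lambda>k. \<F> k E) = \<F>\<^sub>0 E"
    using lim[OF E] by (intro lim_imp_Limsup) auto
  then show "\<exists>Ek. (\<forall>k. Ek k \<in> sets lebesgue) \<and> L1_loc_conv A (\<lambda>k. indicator (Ek k)) (indicator E)
      \<and> limsup (\<lambda>k. \<F> k (Ek k)) \<le> \<F>\<^sub>0 E"
    using E L1_loc_conv_const[OF indicator_in_L1_loc[OF E], of A]
    by (intro exI[of _ "\<lambda>k. E"]) simp
qed

text \<open>
  The truncations of \<open>f\<close> at height \<open>n\<close> on a compact set \<open>K n\<close> change their integral by at most
  \<open>n\<close> times the measure of the part of \<open>K n\<close> where \<open>E\<close> and \<open>Ek k\<close> differ, which tends to \<open>0\<close>.
  Monotone convergence in \<open>n\<close> removes the truncation.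
\<close>

lemma nn_integral_set_le_liminf:
  fixes f :: "'a::euclidean_space \<Rightarrow> ennreal" and Ek :: "nat \<Rightarrow> 'a set"
  assumes f: "f \<in> borel_measurable lebesgue" and \<Omega>: "open \<Omega>" "\<Omega> \<subseteq> A"
    and E: "E \<in> sets lebesgue" and Ek: "\<And>k. Ek k \<in> sets lebesgue"
    and conv: "L1_loc_conv A (\<lambda>k. indicator (Ek k)) (indicator E)"
  shows "(\<integral>\<^sup>+x\<in>E \<inter> \<Omega>. f x \<partial>lebesgue) \<le> liminf (\<lambda>k. \<integral>\<^sup>+x\<in>Ek k \<inter> \<Omega>. f x \<partial>lebesgue)"
proof -
  obtain K where K: "\<And>n. compact (K n)" "\<And>n. K n \<subseteq> \<Omega>" "\<And>n. K n \<subseteq> interior (K (Suc n))"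
    "\<Union> (range K) = \<Omega>"
    using open_Union_compact_subsets[OF \<Omega>(1)] by metis
  have Kmono: "K m \<subseteq> K n" if "m \<le> n" for m n
    by (rule lift_Suc_mono_le[of K]) (use K(3) interior_subset that in blast)+
  have Km: "K n \<in> lmeasurable" for n
    using K(1) by (rule lmeasurable_compact)
  define h where "h n x = min (f x) (of_nat n) * indicator (E \<inter> K n) x" for n x
  have EK: "E \<inter> K n \<in> sets lebesgue" for n
    using E Km by (intro sets.Int) auto
  have hm: "h n \<in> borel_measurable lebesgue" for n
    unfolding h_def[abs_def] using EK f
    by (intro borel_measurable_times_ennreal borel_measurable_min borel_measurable_indicator) auto
  define b where "b k = (\<integral>\<^sup>+x\<in>Ek k \<inter> \<Omega>. f x \<partial>lebesgue)" for k
  have le: "(\<integral>\<^sup>+x. h n x \<partial>lebesgue) \<le> liminf b" for n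
  proof -
    define a :: "nat \<Rightarrow> real" where "a k = (LINT x:K n|lebesgue. \<bar>indicator (Ek k) x - indicator E x\<bar>)" for k
    define H where "H = (\<integral>\<^sup>+x. h n x \<partial>lebesgue)"
    have "K n \<subseteq> A"
      using K(2) \<Omega>(2) by blast
    then have "a \<longlonglongrightarrow> 0"
      using conv K(1) by (simp add: L1_loc_conv_def a_def[abs_def])
    then have lim: "(\<lambda>k. of_nat n * ennreal (a k)) \<longlonglongrightarrow> of_nat n * ennreal 0"
      by (intro tendsto_mult_ennreal tendsto_const tendsto_ennrealI) auto
    have "H \<le> (\<integral>\<^sup>+x. of_nat n * indicator (K n) x \<partial>lebesgue)"
      unfolding H_def by (intro nn_integral_mono) (auto simp: h_def indicator_def)
    also have "\<dots> = of_nat n * emeasure lebesgue (K n)"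
      using Km by (intro nn_integral_cmult_indicator) auto
    also have "\<dots> < \<infinity>"
      using Km[of n] by (simp add: fmeasurable_def ennreal_mult_less_top of_nat_less_top del: emeasure_completion)
    finally have Hfin: "H \<noteq> top"
      by simp
    have "H \<le> b k + of_nat n * ennreal (a k)" for k
    proof -
      let ?d = "\<lambda>x. indicator (K n) x * \<bar>indicator (Ek k) x - indicator E x\<bar> :: real"
      have di: "integrable lebesgue ?d"
        using set_integrable_abs[OF set_integral_diff(1)[of lebesgue "K n" "indicator (Ek k)" "indicator E"]]
          indicator_in_L1_loc[OF E, of UNIV] indicator_in_L1_loc[OF Ek[of k], of UNIV] K(1)[of n]
        by (auto simp: L1_loc_def set_integrable_def)
      have dm: "(\<lambda>x. ennreal (?d x)) \<in> borel_measurable lebesgue"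
        by (rule measurable_compose[OF borel_measurable_integrable[OF di] measurable_ennreal])
      have "H \<le> (\<integral>\<^sup>+x. f x * indicator (Ek k \<inter> \<Omega>) x + of_nat n * ennreal (?d x) \<partial>lebesgue)"
        unfolding H_def using K(2)[of n]
        by (intro nn_integral_mono) (auto simp: h_def indicator_def)
      also have "\<dots> = (\<integral>\<^sup>+x. f x * indicator (Ek k \<inter> \<Omega>) x \<partial>lebesgue) + (\<integral>\<^sup>+x. of_nat n * ennreal (?d x) \<partial>lebesgue)"
      proof (rule nn_integral_add)
        have "Ek k \<inter> \<Omega> \<in> sets lebesgue"
          using Ek \<Omega>(1) by (intro sets.Int) auto
        then show "(\<lambda>x. f x * indicator (Ek k \<inter> \<Omega>) x) \<in> borel_measurable lebesgue"
          using f by (intro borel_measurable_times_ennreal borel_measurable_indicator)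
        show "(\<lambda>x. of_nat n * ennreal (?d x)) \<in> borel_measurable lebesgue"
          by (intro borel_measurable_times_ennreal borel_measurable_const dm)
      qed
      also have "(\<integral>\<^sup>+x. of_nat n * ennreal (?d x) \<partial>lebesgue) = of_nat n * (\<integral>\<^sup>+x. ennreal (?d x) \<partial>lebesgue)"
        by (rule nn_integral_cmult[OF dm])
      also have "(\<integral>\<^sup>+x. ennreal (?d x) \<partial>lebesgue) = ennreal (a k)"
        using nn_integral_eq_integral[OF di] by (simp add: a_def set_lebesgue_integral_def)
      finally show ?thesis
        by (simp add: b_def)
    qed
    then have "H - of_nat n * ennreal (a k) \<le> b k" for k
      using Hfin by (simp add: ennreal_minus_le_iff add.commute)
    then have "liminf (\<lambda>k. H - of_nat n * ennreal (a k)) \<le> liminf b"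
      by (intro Liminf_mono always_eventually allI)
    moreover have "(\<lambda>k. H - of_nat n * ennreal (a k)) \<longlonglongrightarrow> H - of_nat n * ennreal 0"
      using Hfin by (intro tendsto_diff_ennreal tendsto_const lim) auto
    then have "liminf (\<lambda>k. H - of_nat n * ennreal (a k)) = H"
      by (intro lim_imp_Liminf) auto
    ultimately show ?thesis
      by (simp add: H_def)
  qed
  have "(\<lambda>n. \<integral>\<^sup>+x. h n x \<partial>lebesgue) \<longlonglongrightarrow> (\<integral>\<^sup>+x. f x * indicator (E \<inter> \<Omega>) x \<partial>lebesgue)"
  proof (rule nn_integral_LIMSEQ)
    show "incseq h"
    proof (rule incseq_SucI, rule le_funI)
      fix n x
      have "min (f x) (of_nat n) \<le> min (f x) (of_nat (Suc n))"
        by (intro min.mono) auto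
      then show "h n x \<le> h (Suc n) x"
        using Kmono[of n "Suc n"] unfolding h_def
        by (intro mult_mono) (auto simp: indicator_def)
    qed
    fix x
    show "(\<lambda>n. h n x) \<longlonglongrightarrow> f x * indicator (E \<inter> \<Omega>) x"
    proof (cases "x \<in> E \<inter> \<Omega>")
      case True
      then obtain m where m: "x \<in> K m"
        using K(4) by blast
      have "(\<lambda>n. min (f x) (of_nat n)) \<longlonglongrightarrow> min (f x) top"
        by (intro tendsto_min tendsto_const of_nat_tendsto_top_ennreal)
      moreover have "\<forall>\<^sub>F n in sequentially. min (f x) (of_nat n) = h n x"
        using eventually_ge_at_top[of m]
        by eventually_elim (use m True Kmono in \<open>auto simp: h_def indicator_def\<close>)
      ultimately have "(\<lambda>n. h n x) \<longlonglongrightarrow> min (f x) top"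
        by (rule Lim_transform_eventually)
      then show ?thesis
        using True by simp
    next
      case False
      then have "h n x = 0" for n
        using K(2)[of n] by (auto simp: h_def indicator_def)
      then show ?thesis
        using False by simp
    qed
  qed (rule hm)
  then have "(\<integral>\<^sup>+x\<in>E \<inter> \<Omega>. f x \<partial>lebesgue) \<le> liminf b"
    using le by (intro LIMSEQ_le_const2) auto
  then show ?thesis
    by (simp add: b_def[abs_def])
qed

text \<open>
  Exhaust \<open>A\<close> by compact sets, on each of which \<open>u\<close> is integrable.
\<close>

lemma borel_measurable_L1_loc:
  fixes u :: "'a::euclidean_space \<Rightarrow> real"
  assumes A: "open A" and u: "u \<in> L1_loc A"
  shows "(\<lambda>x. indicator A x *\<^sub>R u x) \<in> borel_measurable lebesgue"
proof -
  obtain K where K: "\<And>n. compact (K n)" "\<And>n. K n \<subseteq> A" "\<And>n. K n \<subseteq> interior (K (Suc n))"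
    "\<Union> (range K) = A"
    using open_Union_compact_subsets[OF A] by metis
  have Kmono: "K m \<subseteq> K n" if "m \<le> n" for m n
    by (rule lift_Suc_mono_le[of K]) (use K(3) interior_subset that in blast)+
  show ?thesis
  proof (rule borel_measurable_LIMSEQ_real)
    fix n
    have "integrable lebesgue (\<lambda>x. indicator (K n) x *\<^sub>R u x)"
      using u K by (auto simp: L1_loc_def set_integrable_def)
    then show "(\<lambda>x. indicator (K n) x *\<^sub>R u x) \<in> borel_measurable lebesgue"
      by (rule borel_measurable_integrable)
  next
    fix x
    have "\<forall>\<^sub>F n in sequentially. indicator (K n) x = (indicator A x :: real)"
    proof (cases "x \<in> A")
      case True
      then obtain m where "x \<in> K m"
        using K(4) by blast
      then have "x \<in> K n" if "m \<le> n" for n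
        using Kmono[OF that] by blast
      then show ?thesis
        using True by (intro eventually_mono[OF eventually_ge_at_top[of m]]) simp
    next
      case False
      then show ?thesis
        using K(2) by (intro always_eventually) (auto simp: indicator_def)
    qed
    then have "\<forall>\<^sub>F n in sequentially. indicator (K n) x *\<^sub>R u x = indicator A x *\<^sub>R u x"
      by eventually_elim simp
    then show "(\<lambda>n. indicator (K n) x *\<^sub>R u x) \<longlonglongrightarrow> indicator A x *\<^sub>R u x"
      by (rule tendsto_eventually)
  qed
qed

lemma L1_loc_conv_Compl:
  fixes Ek :: "nat \<Rightarrow> 'a::euclidean_space set"
  assumes E: "E \<in> sets lebesgue" and Ek: "\<And>k. Ek k \<in> sets lebesgue"
    and conv: "L1_loc_conv A (\<lambda>k. indicator (Ek k)) (indicator E)"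
  shows "L1_loc_conv A (\<lambda>k. indicator (- Ek k)) (indicator (- E))"
proof -
  have "\<bar>indicator (- Ek k) x - indicator (- E) x\<bar> = \<bar>indicator (Ek k) x - indicator E x :: real\<bar>" for k x
    by (auto simp: indicator_def)
  then show ?thesis
    using conv E Ek by (simp add: L1_loc_conv_def indicator_in_L1_loc Compl_in_sets_lebesgue)
qed

text \<open>
  Adding the finite total mass of the negative part turns the integral into a sum of two
  nonnegative integrals, one over the set and one over its complement. Both are lower
  semicontinuous, whereas the subtracted integral over the set is not obviously upper
  semicontinuous.
\<close>

lemma ext_integral_plus_neg_part:
  fixes g :: "'a::euclidean_space \<Rightarrow> real"
  assumes g: "g \<in> borel_measurable lebesgue" and E: "E \<in> sets lebesgue" and \<Omega>: "\<Omega> \<in> sets lebesgue"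
    and fin: "neg_part_integrable g \<Omega>"
  shows "ext_integral g (E \<inter> \<Omega>) = enn2ereal (\<integral>\<^sup>+x\<in>E \<inter> \<Omega>. ennreal (g x) \<partial>lebesgue)
    + enn2ereal (\<integral>\<^sup>+x\<in>- E \<inter> \<Omega>. ennreal (- g x) \<partial>lebesgue)
    + - enn2ereal (\<integral>\<^sup>+x\<in>\<Omega>. ennreal (- g x) \<partial>lebesgue)"
proof -
  let ?N = "\<lambda>S. \<integral>\<^sup>+x\<in>S. ennreal (- g x) \<partial>lebesgue"
  have gm: "(\<lambda>x. ennreal (- g x)) \<in> borel_measurable lebesgue"
    using g by measurable
  have S: "E \<inter> \<Omega> \<in> sets lebesgue" "- E \<inter> \<Omega> \<in> sets lebesgue"
    using E \<Omega> by (auto intro!: sets.Int simp: Compl_in_sets_lebesgue)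
  have "?N \<Omega> = (\<integral>\<^sup>+x. ennreal (- g x) * indicator (E \<inter> \<Omega>) x + ennreal (- g x) * indicator (- E \<inter> \<Omega>) x \<partial>lebesgue)"
    by (intro nn_integral_cong) (auto simp: indicator_def)
  also have "\<dots> = ?N (E \<inter> \<Omega>) + ?N (- E \<inter> \<Omega>)"
    using S gm by (intro nn_integral_add borel_measurable_times_ennreal borel_measurable_indicator)
  finally have N: "?N \<Omega> = ?N (E \<inter> \<Omega>) + ?N (- E \<inter> \<Omega>)" .
  then have "?N (E \<inter> \<Omega>) + ?N (- E \<inter> \<Omega>) < top"
    using fin by (simp add: neg_part_integrable_def)
  then have "?N (E \<inter> \<Omega>) \<noteq> top" "?N (- E \<inter> \<Omega>) \<noteq> top"
    by auto
  then obtain p q where pq: "?N (E \<inter> \<Omega>) = ennreal p" "0 \<le> p" "?N (- E \<inter> \<Omega>) = ennreal q" "0 \<le> q"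
    by (cases "?N (E \<inter> \<Omega>)"; cases "?N (- E \<inter> \<Omega>)") auto
  show ?thesis
    unfolding ext_integral_def N pq(1,3)
    by (cases "\<integral>\<^sup>+x\<in>E \<inter> \<Omega>. ennreal (g x) \<partial>lebesgue")
       (use pq in \<open>auto simp: enn2ereal_ennreal simp flip: ennreal_plus\<close>)
qed

lemma liminf_enn2ereal: "liminf (\<lambda>k. enn2ereal (a k)) = enn2ereal (liminf a)"
  by (rule Liminf_compose_continuous_mono[OF continuous_on_enn2ereal])
     (auto simp: mono_def less_eq_ennreal.rep_eq)

text \<open>
  Up to the finite constant \<open>T\<close>, the energy is a sum of three nonnegative lower semicontinuous
  terms: the perimeter, the integral of \<open>max g 0\<close> over the set and that of \<open>max (- g) 0\<close> over the
  complement.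
\<close>

lemma energy_le_liminf:
  fixes Ek :: "nat \<Rightarrow> 'a::euclidean_space set"
  assumes \<Omega>: "open \<Omega>" and g: "g \<in> borel_measurable lebesgue" and fin: "neg_part_integrable g \<Omega>"
    and rk: "\<And>k. 0 < rk k" "rk \<longlonglongrightarrow> r" and r: "0 < r"
    and E: "E \<in> sets lebesgue" and Ek: "\<And>k. Ek k \<in> sets lebesgue"
    and conv: "L1_loc_conv (oplus_ball \<Omega> r) (\<lambda>k. indicator (Ek k)) (indicator E)"
  shows "energy r g E \<Omega> \<le> liminf (\<lambda>k. energy (rk k) g (Ek k) \<Omega>)"
proof -
  define P where "P S = (\<integral>\<^sup>+x\<in>S \<inter> \<Omega>. ennreal (g x) \<partial>lebesgue)" for S
  define N where "N S = (\<integral>\<^sup>+x\<in>- S \<inter> \<Omega>. ennreal (- g x) \<partial>lebesgue)" for S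
  define T where "T = (\<integral>\<^sup>+x\<in>\<Omega>. ennreal (- g x) \<partial>lebesgue)"
  have \<Omega>m: "\<Omega> \<in> sets lebesgue"
    using \<Omega> by simp
  have sub: "\<Omega> \<subseteq> oplus_ball \<Omega> r"
    using r by (auto simp: oplus_ball_def)
  have energy_eq: "energy \<rho> g S \<Omega> = (enn2ereal (Per \<rho> S \<Omega>) + (enn2ereal (P S) + enn2ereal (N S))) + - enn2ereal T"
    if "S \<in> sets lebesgue" for \<rho> S
    using ext_integral_plus_neg_part[OF g that \<Omega>m fin] by (simp add: energy_def P_def N_def T_def add.assoc)
  have T: "\<bar>- enn2ereal T\<bar> \<noteq> \<infinity>"
    using fin by (cases T) (auto simp: neg_part_integrable_def T_def[symmetric] enn2ereal_ennreal)
  have Per: "enn2ereal (Per r E \<Omega>) \<le> liminf (\<lambda>k. enn2ereal (Per (rk k) (Ek k) \<Omega>))"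
    using Per_le_liminf[OF \<Omega>m rk r Ek conv] by (simp add: liminf_enn2ereal less_eq_ennreal.rep_eq)
  have gp: "(\<lambda>x. ennreal (g x)) \<in> borel_measurable lebesgue" "(\<lambda>x. ennreal (- g x)) \<in> borel_measurable lebesgue"
    using g by measurable
  have P: "enn2ereal (P E) \<le> liminf (\<lambda>k. enn2ereal (P (Ek k)))"
    using nn_integral_set_le_liminf[OF gp(1) \<Omega> sub E Ek conv]
    by (simp add: liminf_enn2ereal less_eq_ennreal.rep_eq P_def)
  have N: "enn2ereal (N E) \<le> liminf (\<lambda>k. enn2ereal (N (Ek k)))"
    using nn_integral_set_le_liminf[OF gp(2) \<Omega> sub _ _ L1_loc_conv_Compl[OF E Ek conv]] E Ek
    by (simp add: liminf_enn2ereal less_eq_ennreal.rep_eq N_def Compl_in_sets_lebesgue)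
  have "enn2ereal (P E) + enn2ereal (N E) \<le> liminf (\<lambda>k. enn2ereal (P (Ek k))) + liminf (\<lambda>k. enn2ereal (N (Ek k)))"
    using P N by (rule add_mono)
  also have "\<dots> \<le> liminf (\<lambda>k. enn2ereal (P (Ek k)) + enn2ereal (N (Ek k)))"
    by (intro Liminf_add_le always_eventually allI) auto
  finally have PN: "enn2ereal (P E) + enn2ereal (N E) \<le> \<dots>" .
  have "enn2ereal (Per r E \<Omega>) + (enn2ereal (P E) + enn2ereal (N E))
      \<le> liminf (\<lambda>k. enn2ereal (Per (rk k) (Ek k) \<Omega>)) + liminf (\<lambda>k. enn2ereal (P (Ek k)) + enn2ereal (N (Ek k)))"
    using Per PN by (rule add_mono)
  also have "\<dots> \<le> liminf (\<lambda>k. enn2ereal (Per (rk k) (Ek k) \<Omega>) + (enn2ereal (P (Ek k)) + enn2ereal (N (Ek k))))"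
    by (intro Liminf_add_le always_eventually allI) auto
  finally have "energy r g E \<Omega> \<le> liminf (\<lambda>k. enn2ereal (Per (rk k) (Ek k) \<Omega>)
      + (enn2ereal (P (Ek k)) + enn2ereal (N (Ek k)))) + - enn2ereal T"
    unfolding energy_eq[OF E] by (rule add_right_mono)
  also have "\<dots> = liminf (\<lambda>k. energy (rk k) g (Ek k) \<Omega>)"
    unfolding energy_eq[OF Ek] using T by (intro Liminf_add_ereal_right[symmetric]) auto
  finally show ?thesis .
qed

section \<open>Weak limits of characteristic functions\<close>

text \<open>
  With \<open>a = b\<close> this says that an almost everywhere constant function has no oscillation, with
  \<open>a = 0\<close> and \<open>b = 1\<close> that the oscillation of a function with values in \<open>[0, 1]\<close> is at most \<open>1\<close>.
\<close>

lemma osc_le_diff: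
  fixes u :: "'a::euclidean_space \<Rightarrow> real"
  assumes B: "B \<in> sets lebesgue" and u: "(\<lambda>x. indicator B x *\<^sub>R u x) \<in> borel_measurable lebesgue"
    and ab: "AE y in lebesgue. y \<in> B \<longrightarrow> a \<le> u y \<and> u y \<le> b"
  shows "osc B u \<le> ereal (b - a)"
proof -
  let ?M = "restrict_space lebesgue B"
  have B': "B \<inter> space lebesgue \<in> sets lebesgue"
    using B by simp
  have um: "u \<in> borel_measurable ?M"
    using u B' by (subst borel_measurable_restrict_space_iff)
  have "AE y in ?M. a \<le> u y \<and> u y \<le> b"
    using ab by (subst AE_restrict_space_iff[OF B'])
  then have "AE y in ?M. ereal (u y) \<le> ereal b" "AE y in ?M. ereal (- u y) \<le> ereal (- a)"
    by (auto elim: eventually_mono)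
  then have "ess_sup_on B u \<le> ereal b" "ess_sup_on B (\<lambda>y. - u y) \<le> ereal (- a)"
    unfolding ess_sup_on_def using um by (intro esssup_I; measurable)+
  then have "ess_sup_on B u + ess_sup_on B (\<lambda>y. - u y) \<le> ereal b + ereal (- a)"
    by (rule add_mono)
  then show ?thesis
    by (simp add: osc_def ess_inf_on_def minus_ereal_def)
qed

text \<open>
  An open ball is a countable union of smaller concentric ones. The estimate on the perimeter
  requires a radius strictly less than \<open>r\<close>, which this provides.
\<close>

lemma not_negligible_Int_smaller_ball:
  fixes S :: "'a::euclidean_space set"
  assumes "\<not> negligible (S \<inter> ball x r)"
  shows "\<exists>r'<r. \<forall>s\<ge>r'. \<not> negligible (S \<inter> ball x s)"
proof -
  have "S \<inter> ball x r \<subseteq> (\<Union>n. S \<inter> ball x (r - inverse (real (Suc n))))"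
  proof
    fix y assume y: "y \<in> S \<inter> ball x r"
    then obtain n where "inverse (real (Suc n)) < r - dist x y"
      using reals_Archimedean[of "r - dist x y"] by auto
    then show "y \<in> (\<Union>n. S \<inter> ball x (r - inverse (real (Suc n))))"
      using y by (auto intro!: exI[of _ n])
  qed
  then obtain n where n: "\<not> negligible (S \<inter> ball x (r - inverse (real (Suc n))))"
    using assms negligible_Union_nat[of "\<lambda>n. S \<inter> ball x (r - inverse (real (Suc n)))"]
    by (meson negligible_subset)
  show ?thesis
  proof (intro exI conjI allI impI)
    show "r - inverse (real (Suc n)) < r"
      by simp
    fix s assume "r - inverse (real (Suc n)) \<le> s"
    then show "\<not> negligible (S \<inter> ball x s)"
      using n subset_ball[of "r - inverse (real (Suc n))" s x]
      by (meson Int_mono negligible_subset order_refl)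
  qed
qed

context
  fixes \<Omega> :: "'a::euclidean_space set" and u :: "'a \<Rightarrow> real" and Ek :: "nat \<Rightarrow> 'a set"
    and r :: real and rk :: "nat \<Rightarrow> real"
  assumes \<Omega>: "open \<Omega>"
    and r: "0 < r" "rk \<longlonglongrightarrow> r" and rk: "\<And>k. 0 < rk k"
    and Ek: "\<And>k. Ek k \<in> sets lebesgue"
    and u: "\<And>x. 0 \<le> u x" "\<And>x. u x \<le> 1"
    and weak: "weak_L1_loc_conv \<Omega> (\<lambda>k. indicator (Ek k)) u"
begin

lemma transition_set_measurable: "{x\<in>\<Omega>. 0 < u x \<and> u x < 1} \<in> sets lebesgue"
proof -
  have v: "(\<lambda>x. indicator \<Omega> x *\<^sub>R u x) \<in> borel_measurable lebesgue"
    using weak \<Omega> by (intro borel_measurable_L1_loc) (auto simp: weak_L1_loc_conv_def)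
  then have "{x\<in>space lebesgue. 0 < indicator \<Omega> x *\<^sub>R u x \<and> indicator \<Omega> x *\<^sub>R u x < 1} \<in> sets lebesgue"
    by (intro sets.sets_Collect_conj borel_measurable_less borel_measurable_const)
  moreover have "{x\<in>space lebesgue. 0 < indicator \<Omega> x *\<^sub>R u x \<and> indicator \<Omega> x *\<^sub>R u x < 1}
      = {x\<in>\<Omega>. 0 < u x \<and> u x < 1}"
    by (auto simp: indicator_def split: if_splits)
  ultimately show ?thesis
    by simp
qed

text \<open>
  A density-one point \<open>y\<close> of \<open>S = {0 < u < 1}\<close> may lie on the boundary of \<open>\<Omega>\<close>, where there is no
  information on \<open>u\<close>. It is replaced by a nearby density-one point \<open>z\<close> that belongs to \<open>S\<close>, hence
  to \<open>\<Omega>\<close>; such points exist by the density theorem.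
\<close>

lemma emeasure_oplus_transition_le:
  "emeasure lebesgue (oplus_ball (density_one {x\<in>\<Omega>. 0 < u x \<and> u x < 1}) r \<inter> \<Omega>)
    \<le> 2 * ennreal r * liminf (\<lambda>k. Per (rk k) (Ek k) \<Omega>)"
proof -
  define S where "S = {x\<in>\<Omega>. 0 < u x \<and> u x < 1}"
  have S: "S \<in> sets lebesgue"
    using transition_set_measurable by (simp add: S_def)
  have \<Omega>m: "\<Omega> \<in> sets lebesgue"
    using \<Omega> by simp
  have "(\<integral>\<^sup>+x\<in>\<Omega>. indicator (oplus_ball (density_one S) r) x \<partial>lebesgue)
      \<le> 2 * ennreal r * liminf (\<lambda>k. Per (rk k) (Ek k) \<Omega>)"
  proof (rule nn_integral_le_liminf_Per[OF \<Omega>m rk r(2,1)], intro conjI)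
    fix x assume x: "x \<in> \<Omega>" "indicator (oplus_ball (density_one S) r) x \<noteq> (0::ennreal)"
    then obtain y where y: "y \<in> density_one S" "dist x y < r"
      by (auto simp: mem_oplus_ball indicator_def split: if_splits)
    have "\<not> negligible (S \<inter> ball y (r - dist x y))"
      using density_one_ball_not_negligible[OF y(1)] y(2) by simp
    then obtain z where z: "z \<in> S" "z \<in> ball y (r - dist x y)" "z \<in> density_one S"
      using Int_density_one_nonempty[OF S] by blast
    have xz: "dist x z < r"
      using z(2) dist_triangle[of x z y] by simp
    obtain \<delta> where \<delta>: "\<delta> > 0" "cball z \<delta> \<subseteq> \<Omega>"
      using z(1) \<Omega> open_contains_cball unfolding S_def by blast
    define e where "e = min \<delta> ((r - dist x z) / 2)"
    have e: "0 < e" "e \<le> \<delta>" "dist x z + e < r"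
      using \<delta>(1) xz by (auto simp: e_def min_def field_simps)
    have cb: "cball z e \<subseteq> \<Omega>"
      using \<delta>(2) e(2) by (meson subset_cball subset_trans)
    have "\<not> negligible (S \<inter> ball z e)"
      by (rule density_one_ball_not_negligible[OF z(3) e(1)])
    then have "\<not> negligible {w \<in> ball z e. u w \<noteq> 0}" "\<not> negligible {w \<in> ball z e. u w \<noteq> 1}"
      by (auto simp: S_def elim!: contrapos_nn negligible_subset)
    then have "\<forall>\<^sub>F k in sequentially. frontier (density_one (Ek k)) \<inter> ball z e \<noteq> {}"
      by (intro weak_limit_frontier_meets_ball[OF weak Ek u cb])
    moreover have "ball z e \<subseteq> ball x (dist x z + e)"
      by (simp add: ball_subset_ball_iff dist_commute)
    ultimately have "\<forall>\<^sub>F k in sequentially. frontier (density_one (Ek k)) \<inter> ball x (dist x z + e) \<noteq> {}"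
      by (elim eventually_mono) blast
    then show "\<exists>r'<r. \<forall>\<^sub>F k in sequentially. frontier (density_one (Ek k)) \<inter> ball x r' \<noteq> {}"
      using e(3) by blast
  qed (simp add: indicator_def)
  also have "(\<integral>\<^sup>+x\<in>\<Omega>. indicator (oplus_ball (density_one S) r) x \<partial>lebesgue)
      = emeasure lebesgue (oplus_ball (density_one S) r \<inter> \<Omega>)"
    using \<Omega>m by (simp add: indicator_inter_arith[symmetric] oplus_ball_Int_sets_lebesgue del: emeasure_completion)
  finally show ?thesis
    by (simp add: S_def)
qed

text \<open>
  On a compact set \<open>K\<close> outside \<open>\<Sigma>\<close>, \<open>u\<close> is almost everywhere \<open>0\<close> or \<open>1\<close>, where
  \<open>|\<chi> - u| = \<chi> \<phi> + u\<close> with \<open>\<phi> = 1 - 2 u\<close>. So the \<open>L\<^sup>1\<close> distance converges to the integral of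
  \<open>u \<phi> + u = 2 u (1 - u) = 0\<close>.
\<close>

lemma L1_loc_conv_off_transition:
  "L1_loc_conv (\<Omega> - density_one {x\<in>\<Omega>. 0 < u x \<and> u x < 1}) (\<lambda>k. indicator (Ek k)) u"
proof -
  define S where "S = {x\<in>\<Omega>. 0 < u x \<and> u x < 1}"
  have S: "S \<in> sets lebesgue"
    using transition_set_measurable by (simp add: S_def)
  have "(\<lambda>k. LINT x:K|lebesgue. \<bar>indicator (Ek k) x - u x\<bar>) \<longlonglongrightarrow> 0"
    if K: "compact K" "K \<subseteq> \<Omega> - density_one S" for K
  proof -
    have K\<Omega>: "K \<subseteq> \<Omega>"
      using K(2) by blast
    have ui: "set_integrable lebesgue K u"
      using weak K(1) K\<Omega> by (auto simp: weak_L1_loc_conv_def L1_loc_def)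
    have uK: "(\<lambda>x. indicator K x * u x) \<in> borel_measurable lebesgue"
      using ui by (auto simp: set_integrable_def dest: borel_measurable_integrable)
    have "negligible (S - density_one S)"
      by (rule negligible_Diff_density_one[OF S])
    then have "negligible {x. \<not> (x \<in> K \<longrightarrow> u x = 0 \<or> u x = 1)}"
    proof (rule negligible_subset)
      show "{x. \<not> (x \<in> K \<longrightarrow> u x = 0 \<or> u x = 1)} \<subseteq> S - density_one S"
        using K(2) u by (auto simp: S_def less_le)
    qed
    then have ae: "AE x in lebesgue. x \<in> K \<longrightarrow> u x = 0 \<or> u x = 1"
      by (rule negligible_imp_AE)
    define \<phi> where "\<phi> x = 1 - 2 * (indicator K x * u x)" for x
    have \<phi>m: "\<phi> \<in> borel_measurable lebesgue"
      unfolding \<phi>_def[abs_def] using uK by measurable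
    have \<phi>b: "\<bar>\<phi> x\<bar> \<le> 1" for x
      using u[of x] by (auto simp: \<phi>_def indicator_def)
    then have "bounded (range \<phi>)"
      by (auto simp: bounded_iff)
    then have "(\<lambda>k. LINT x:K|lebesgue. indicator (Ek k) x * \<phi> x) \<longlonglongrightarrow> (LINT x:K|lebesgue. u x * \<phi> x)"
      using weak[unfolded weak_L1_loc_conv_def, THEN conjunct2, THEN conjunct2, rule_format, of K \<phi>]
        K(1) K\<Omega> \<phi>m by blast
    then have lim: "(\<lambda>k. (LINT x:K|lebesgue. indicator (Ek k) x * \<phi> x) + (LINT x:K|lebesgue. u x))
        \<longlonglongrightarrow> (LINT x:K|lebesgue. u x * \<phi> x) + (LINT x:K|lebesgue. u x)"
      by (intro tendsto_add tendsto_const)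
    have ei: "set_integrable lebesgue K (indicator (Ek k) :: 'a \<Rightarrow> real)" for k
      using indicator_in_L1_loc[OF Ek[of k], of UNIV] K(1) by (simp add: L1_loc_def)
    have e\<phi>: "set_integrable lebesgue K (\<lambda>x. indicator (Ek k) x * \<phi> x)" for k
      by (rule set_integrable_mult_bounded[OF ei \<phi>m \<phi>b])
    have u\<phi>: "set_integrable lebesgue K (\<lambda>x. u x * \<phi> x)"
      by (rule set_integrable_mult_bounded[OF ui \<phi>m \<phi>b])
    have eq: "(LINT x:K|lebesgue. \<bar>indicator (Ek k) x - u x\<bar>)
        = (LINT x:K|lebesgue. indicator (Ek k) x * \<phi> x) + (LINT x:K|lebesgue. u x)" for k
    proof -
      have "(LINT x:K|lebesgue. \<bar>indicator (Ek k) x - u x\<bar>)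
          = (LINT x:K|lebesgue. indicator (Ek k) x * \<phi> x + u x)"
        unfolding set_lebesgue_integral_def
      proof (rule integral_cong_AE)
        show "(\<lambda>x. indicator K x *\<^sub>R \<bar>indicator (Ek k) x - u x\<bar>) \<in> borel_measurable lebesgue"
          using set_integrable_abs[OF set_integral_diff(1)[OF ei ui]]
          by (auto simp: set_integrable_def dest: borel_measurable_integrable)
        show "(\<lambda>x. indicator K x *\<^sub>R (indicator (Ek k) x * \<phi> x + u x)) \<in> borel_measurable lebesgue"
          using set_integral_add(1)[OF e\<phi> ui]
          by (auto simp: set_integrable_def dest: borel_measurable_integrable)
        show "AE x in lebesgue. indicator K x *\<^sub>R \<bar>indicator (Ek k) x - u x\<bar>
            = indicator K x *\<^sub>R (indicator (Ek k) x * \<phi> x + u x)"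
          using ae by eventually_elim (auto simp: \<phi>_def indicator_def)
      qed
      also have "\<dots> = (LINT x:K|lebesgue. indicator (Ek k) x * \<phi> x) + (LINT x:K|lebesgue. u x)"
        by (rule set_integral_add(2)[OF e\<phi> ui])
      finally show ?thesis .
    qed
    have "(LINT x:K|lebesgue. u x * \<phi> x) + (LINT x:K|lebesgue. u x) = (LINT x:K|lebesgue. u x * \<phi> x + u x)"
      by (rule set_integral_add(2)[OF u\<phi> ui, symmetric])
    also have "\<dots> = 0"
      unfolding set_lebesgue_integral_def
    proof (rule integral_eq_zero_AE)
      show "AE x in lebesgue. indicator K x *\<^sub>R (u x * \<phi> x + u x) = 0"
        using ae by eventually_elim (auto simp: \<phi>_def indicator_def)
    qed
    finally show ?thesis
      using lim by (simp add: eq)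
  qed
  moreover have "u \<in> L1_loc (\<Omega> - density_one S)"
    using weak by (auto simp: weak_L1_loc_conv_def L1_loc_def)
  ultimately show ?thesis
    using Ek by (simp add: L1_loc_conv_def S_def[symmetric] indicator_in_L1_loc)
qed

text \<open>
  Where the oscillation over \<open>ball x r\<close> is positive, \<open>u\<close> is not almost everywhere constant there.
  In particular it is neither almost everywhere \<open>0\<close> nor \<open>1\<close>, and this remains true on a slightly
  smaller ball. So the oscillation, being at most \<open>1\<close>, satisfies the hypothesis of
  \<open>nn_integral_le_liminf_Per\<close>.
\<close>

lemma integral_osc_le:
  assumes weak': "weak_L1_loc_conv (oplus_ball \<Omega> r) (\<lambda>k. indicator (Ek k)) u"
  shows "(\<integral>\<^sup>+x\<in>\<Omega>. e2ennreal (osc (ball x r) u) \<partial>lebesgue)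
    \<le> 2 * ennreal r * liminf (\<lambda>k. Per (rk k) (Ek k) \<Omega>)"
proof (rule nn_integral_le_liminf_Per[OF _ rk r(2,1)], goal_cases)
  case 1
  show ?case
    using \<Omega> by simp
next
  case (2 x)
  let ?A = "oplus_ball \<Omega> r"
  have sub: "ball x r \<subseteq> ?A"
    using 2(1) by (auto simp: oplus_ball_def)
  have "u \<in> L1_loc ?A"
    using weak' by (simp add: weak_L1_loc_conv_def)
  then have v: "(\<lambda>y. indicator ?A y *\<^sub>R u y) \<in> borel_measurable lebesgue"
    by (intro borel_measurable_L1_loc open_oplus_ball)
  have "(\<lambda>y. indicator (ball x r) y *\<^sub>R (indicator ?A y *\<^sub>R u y)) \<in> borel_measurable lebesgue"
    by (rule borel_measurable_scaleR[OF borel_measurable_indicator v]) simp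
  also have "(\<lambda>y. indicator (ball x r) y *\<^sub>R (indicator ?A y *\<^sub>R u y)) = (\<lambda>y. indicator (ball x r) y *\<^sub>R u y)"
    using sub by (intro ext) (auto simp: indicator_def simp del: mem_ball)
  finally have um: "(\<lambda>y. indicator (ball x r) y *\<^sub>R u y) \<in> borel_measurable lebesgue" .
  have osc_le: "osc (ball x r) u \<le> ereal (b - a)"
    if "negligible {y. \<not> (y \<in> ball x r \<longrightarrow> a \<le> u y \<and> u y \<le> b)}" for a b
    using that by (intro osc_le_diff[OF _ um] negligible_imp_AE) auto
  have "osc (ball x r) u \<le> ereal 1"
    using osc_le[of 0 1] u by simp
  then have le1: "e2ennreal (osc (ball x r) u) \<le> 1"
    using e2ennreal_mono[of "osc (ball x r) u" "ereal 1"] by simp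
  have nonconst: "\<not> negligible ({y. u y \<noteq> c} \<inter> ball x r)" for c
  proof
    assume "negligible ({y. u y \<noteq> c} \<inter> ball x r)"
    then have "osc (ball x r) u \<le> ereal (c - c)"
      by (intro osc_le) (auto elim: negligible_subset)
    then show False
      using 2(2) by (simp add: e2ennreal_neg zero_ereal_def[symmetric])
  qed
  obtain r0 where r0: "r0 < r" "\<And>s. s \<ge> r0 \<Longrightarrow> \<not> negligible ({y. u y \<noteq> 0} \<inter> ball x s)"
    using not_negligible_Int_smaller_ball[OF nonconst[of 0]] by blast
  obtain r1 where r1: "r1 < r" "\<And>s. s \<ge> r1 \<Longrightarrow> \<not> negligible ({y. u y \<noteq> 1} \<inter> ball x s)"
    using not_negligible_Int_smaller_ball[OF nonconst[of 1]] by blast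
  define e where "e = max r0 r1"
  have e: "e < r"
    using r0(1) r1(1) by (simp add: e_def)
  have "cball x e \<subseteq> ?A"
    using sub e by (auto simp: subset_iff)
  moreover have "{y \<in> ball x e. u y \<noteq> c} = {y. u y \<noteq> c} \<inter> ball x e" for c
    by auto
  ultimately have "\<forall>\<^sub>F k in sequentially. frontier (density_one (Ek k)) \<inter> ball x e \<noteq> {}"
    using r0(2)[of e] r1(2)[of e]
    by (intro weak_limit_frontier_meets_ball[OF weak' Ek u]) (auto simp: e_def)
  then show ?case
    using e le1 by blast
qed

end

theorem theorem1p4:
  fixes \<Omega> :: "'a::euclidean_space set" and g :: "'a \<Rightarrow> real"
    and r :: real and rk :: "nat \<Rightarrow> real"
  assumes \<Omega>: "(open \<Omega> \<and> bounded \<Omega>) \<or> \<Omega> = UNIV"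
    and g: "g \<in> L1_loc UNIV"
    and rk: "\<And>k. rk k > 0"
    and r: "r > 0" "rk \<longlonglongrightarrow> r"
  shows
    "(\<forall>E\<in>sets lebesgue.
        (\<lambda>k. Per (rk k) E \<Omega>) \<longlonglongrightarrow> Per r E \<Omega> \<and>
        (\<lambda>k. energy (rk k) g E \<Omega>) \<longlonglongrightarrow> energy r g E \<Omega>)
     \<and>
     Gamma_conv (oplus_ball \<Omega> r) (\<lambda>k E. Per (rk k) E \<Omega>) (\<lambda>E. Per r E \<Omega>) \<and>
     (neg_part_integrable g \<Omega> \<longrightarrow>
        Gamma_conv (oplus_ball \<Omega> r) (\<lambda>k E. energy (rk k) g E \<Omega>) (\<lambda>E. energy r g E \<Omega>))
     \<and>
     (\<forall>(Ek :: nat \<Rightarrow> 'a set) (s :: nat \<Rightarrow> nat) (u :: 'a \<Rightarrow> real).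
        (\<forall>k. Ek k \<in> sets lebesgue) \<and>
        (SUP k. Per (rk k) (Ek k) \<Omega>) < \<infinity> \<and>
        strict_mono s \<and>
        (\<forall>x. 0 \<le> u x \<and> u x \<le> 1) \<and>
        weak_L1_loc_conv \<Omega> (\<lambda>k. indicator (Ek (s k))) u \<longrightarrow>
        (let \<Sigma> = density_one {x\<in>\<Omega>. 0 < u x \<and> u x < 1};
             l = liminf (\<lambda>k. Per (rk (s k)) (Ek (s k)) \<Omega>)
         in emeasure lebesgue (oplus_ball \<Sigma> r \<inter> \<Omega>) \<le> 2 * l * ennreal r \<and>
            L1_loc_conv (\<Omega> - \<Sigma>) (\<lambda>k. indicator (Ek (s k))) u \<and>
            (weak_L1_loc_conv (oplus_ball \<Omega> r) (\<lambda>k. indicator (Ek (s k))) u \<longrightarrow>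
               (\<integral>\<^sup>+x\<in>\<Omega>. e2ennreal (osc (ball x r) u) \<partial>lebesgue) \<le> 2 * ennreal r * l)))"
proof (intro conjI ballI impI allI)
  have "open \<Omega>"
    using \<Omega> by auto
  then have \<Omega>m: "\<Omega> \<in> sets lebesgue"
    by simp
  show "(\<lambda>k. Per (rk k) E \<Omega>) \<longlonglongrightarrow> Per r E \<Omega>" for E
    by (rule Per_tendsto[OF \<Omega> r rk])
  show "(\<lambda>k. energy (rk k) g E \<Omega>) \<longlonglongrightarrow> energy r g E \<Omega>" for E
    by (rule energy_tendsto[OF \<Omega> r rk])
  show "Gamma_conv (oplus_ball \<Omega> r) (\<lambda>k E. Per (rk k) E \<Omega>) (\<lambda>E. Per r E \<Omega>)"
    by (intro Gamma_convI Per_le_liminf[OF \<Omega>m rk r(2,1)] Per_tendsto[OF \<Omega> r rk])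
  show "Gamma_conv (oplus_ball \<Omega> r) (\<lambda>k E. energy (rk k) g E \<Omega>) (\<lambda>E. energy r g E \<Omega>)"
    if "neg_part_integrable g \<Omega>"
  proof -
    have "g \<in> borel_measurable lebesgue"
      using borel_measurable_L1_loc[OF open_UNIV g] by simp
    then show ?thesis
      by (intro Gamma_convI energy_le_liminf[OF \<open>open \<Omega>\<close> _ that rk r(2,1)] energy_tendsto[OF \<Omega> r rk])
  qed
  fix Ek :: "nat \<Rightarrow> 'a set" and s :: "nat \<Rightarrow> nat" and u :: "'a \<Rightarrow> real"
  assume *: "(\<forall>k. Ek k \<in> sets lebesgue) \<and> (SUP k. Per (rk k) (Ek k) \<Omega>) < \<infinity> \<and> strict_mono s \<and>
        (\<forall>x. 0 \<le> u x \<and> u x \<le> 1) \<and> weak_L1_loc_conv \<Omega> (\<lambda>k. indicator (Ek (s k))) u"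
  have rs: "(\<lambda>k. rk (s k)) \<longlonglongrightarrow> r"
    using LIMSEQ_subseq_LIMSEQ[OF r(2), of s] * by (simp add: o_def)
  have Es: "Ek (s k) \<in> sets lebesgue" and u: "0 \<le> u x" "u x \<le> 1"
    and weak: "weak_L1_loc_conv \<Omega> (\<lambda>k. indicator (Ek (s k))) u" for k x
    using * by auto
  note part = \<open>open \<Omega>\<close> r(1) rs rk Es u weak
  show "let \<Sigma> = density_one {x\<in>\<Omega>. 0 < u x \<and> u x < 1};
             l = liminf (\<lambda>k. Per (rk (s k)) (Ek (s k)) \<Omega>)
         in emeasure lebesgue (oplus_ball \<Sigma> r \<inter> \<Omega>) \<le> 2 * l * ennreal r \<and>
            L1_loc_conv (\<Omega> - \<Sigma>) (\<lambda>k. indicator (Ek (s k))) u \<and>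
            (weak_L1_loc_conv (oplus_ball \<Omega> r) (\<lambda>k. indicator (Ek (s k))) u \<longrightarrow>
               (\<integral>\<^sup>+x\<in>\<Omega>. e2ennreal (osc (ball x r) u) \<partial>lebesgue) \<le> 2 * ennreal r * l)"
    unfolding Let_def
  proof (intro conjI impI)
    show "emeasure lebesgue (oplus_ball (density_one {x\<in>\<Omega>. 0 < u x \<and> u x < 1}) r \<inter> \<Omega>)
        \<le> 2 * liminf (\<lambda>k. Per (rk (s k)) (Ek (s k)) \<Omega>) * ennreal r"
      using emeasure_oplus_transition_le[OF part] by (simp only: mult.assoc mult.commute[of "ennreal r"])
  qed (intro L1_loc_conv_off_transition[OF part] integral_osc_le[OF part])+
qed

end
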